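(* There are a computable function $f$ and an algorithm that, given a finite simple connected undirected graph $G$ with at least two vertices and a set $X\subseteq V(G)$ of size $d$ such that $G\setminus X$ is a threshold graph, runs in time $f(d)\cdot|V(G)|^{O(1)}$ and finds a conflict-free open neighborhood coloring of $G$ with $k$ colors, for some $k$ satisfying $\chi_{cf}(G)\le k\le \chi_{cf}(G)+2$.
   Context: A threshold graph is a graph that can be constructed recursively (starting from a single vertex) by repeatedly adding an isolated vertex or a universal vertex (a vertex adjacent to all other current vertices). $G\setminus X$ is the graph obtained from $G$ by deleting the vertices of $X$. Let $N(v)$ be the open neighborhood of $v$ (the set of vertices adjacent to $v$). For a coloring $C_G:V(G)\to\{1,\dots,k\}$ (not necessarily proper), a set $U\subseteq V(G)$ has a unique color if there is a color $c$ with $|\{u\in U: C_G(u)=c\}|=1$. The coloring is a conflict-free open neighborhood (CF-ON) coloring if $N(v)$ has a unique color for every $v\in V(G)$. $\chi_{cf}(G)$ denotes the minimum number of colors in a CF-ON coloring of $G$. *)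

theory Defs
  imports "Graph_Theory.Digraph_Component"
begin

section \<open>Graphs and colorings\<close>

text \<open>
  A finite simple undirected graph is a \<open>pair_graph\<close>: a finite, loopless, symmetric
  set of arcs, where the edge \<open>uv\<close> is the pair of arcs \<open>(u, v)\<close> and \<open>(v, u)\<close>.
\<close>

definition delete_verts :: "'a pair_pre_digraph \<Rightarrow> 'a set \<Rightarrow> 'a pair_pre_digraph" where
  "delete_verts G X =
     \<lparr> pverts = pverts G - X, parcs = {(u, v) \<in> parcs G. u \<notin> X \<and> v \<notin> X} \<rparr>"

lemma (in pair_wf_digraph) with_proj_delete_verts:
  "with_proj (delete_verts G X) = with_proj G \<restriction> (pverts G - X)"
  by (auto simp: delete_verts_def with_proj_def induce_subgraph_def
      dest: in_arcsD1 in_arcsD2)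

inductive threshold :: "'a pair_pre_digraph \<Rightarrow> bool" where
  single: "threshold \<lparr> pverts = {v}, parcs = {} \<rparr>"
| isolated: "threshold G \<Longrightarrow> v \<notin> pverts G \<Longrightarrow>
    threshold \<lparr> pverts = insert v (pverts G), parcs = parcs G \<rparr>"
| universal: "threshold G \<Longrightarrow> v \<notin> pverts G \<Longrightarrow>
    threshold \<lparr> pverts = insert v (pverts G),
                parcs = parcs G \<union> {v} \<times> pverts G \<union> pverts G \<times> {v} \<rparr>"

definition nbhd :: "'a pair_pre_digraph \<Rightarrow> 'a \<Rightarrow> 'a set" where
  "nbhd G v = {u. (v, u) \<in> parcs G}"

definition has_unique_color :: "('a \<Rightarrow> nat) \<Rightarrow> 'a set \<Rightarrow> bool" where
  "has_unique_color C U \<longleftrightarrow> (\<exists>c. card {u \<in> U. C u = c} = 1)"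

definition cf_on_coloring :: "'a pair_pre_digraph \<Rightarrow> nat \<Rightarrow> ('a \<Rightarrow> nat) \<Rightarrow> bool" where
  "cf_on_coloring G k C \<longleftrightarrow>
     (\<forall>v \<in> pverts G. C v \<in> {1..k}) \<and> (\<forall>v \<in> pverts G. has_unique_color C (nbhd G v))"

text \<open>Meaningful only if some such coloring exists, i.e. if \<open>G\<close> has no isolated vertex.\<close>

definition chi_cf :: "'a pair_pre_digraph \<Rightarrow> nat" where
  "chi_cf G = (LEAST k. \<exists>C. cf_on_coloring G k C)"

section \<open>Model of computation\<close>

text \<open>
  A random access machine in structured form. A program uses finitely many variables, each an
  unbounded array of natural numbers with indirect addressing; a scalar variable is an array used
  at index 0. The arithmetic operations are addition and truncated subtraction. Time is the number
  of elementary operations. As no operation increases the bit length of the largest number that has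
  occurred by more than one, this time measure is polynomially related to Turing machine time.
\<close>

type_synonym var = string
type_synonym store = "var \<Rightarrow> nat \<Rightarrow> nat"

datatype aexp = Num nat | Read var aexp | Add aexp aexp | Sub aexp aexp

datatype bexp = Less aexp aexp | Neg bexp | Conj bexp bexp

datatype com = Skip | Write var aexp aexp | Seq com com | Cond bexp com com | Loop bexp com

fun aval :: "aexp \<Rightarrow> store \<Rightarrow> nat" where
  "aval (Num m) s = m"
| "aval (Read x i) s = s x (aval i s)"
| "aval (Add a b) s = aval a s + aval b s"
| "aval (Sub a b) s = aval a s - aval b s"

fun bval :: "bexp \<Rightarrow> store \<Rightarrow> bool" where
  "bval (Less a b) s \<longleftrightarrow> aval a s < aval b s"
| "bval (Neg b) s \<longleftrightarrow> \<not> bval b s"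
| "bval (Conj b c) s \<longleftrightarrow> bval b s \<and> bval c s"

fun acost :: "aexp \<Rightarrow> nat" where
  "acost (Num m) = 1"
| "acost (Read x i) = acost i + 1"
| "acost (Add a b) = acost a + acost b + 1"
| "acost (Sub a b) = acost a + acost b + 1"

fun bcost :: "bexp \<Rightarrow> nat" where
  "bcost (Less a b) = acost a + acost b + 1"
| "bcost (Neg b) = bcost b + 1"
| "bcost (Conj b c) = bcost b + bcost c + 1"

text \<open>\<open>exec p s t s'\<close>: started in store \<open>s\<close>, program \<open>p\<close> halts after time \<open>t\<close> in store \<open>s'\<close>.\<close>

inductive exec :: "com \<Rightarrow> store \<Rightarrow> nat \<Rightarrow> store \<Rightarrow> bool" where
  Skip: "exec Skip s 1 s"
| Write: "exec (Write x i a) s (acost i + acost a + 1) (s(x := (s x)(aval i s := aval a s)))"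
| Seq: "exec p s t s' \<Longrightarrow> exec q s' u s'' \<Longrightarrow> exec (Seq p q) s (t + u) s''"
| CondTrue: "bval b s \<Longrightarrow> exec p s t s' \<Longrightarrow> exec (Cond b p q) s (bcost b + t + 1) s'"
| CondFalse: "\<not> bval b s \<Longrightarrow> exec q s t s' \<Longrightarrow> exec (Cond b p q) s (bcost b + t + 1) s'"
| LoopFalse: "\<not> bval b s \<Longrightarrow> exec (Loop b p) s (bcost b + 1) s"
| LoopTrue: "bval b s \<Longrightarrow> exec p s t s' \<Longrightarrow> exec (Loop b p) s' u s'' \<Longrightarrow>
    exec (Loop b p) s (bcost b + t + u + 1) s''"

inductive_cases exec_SkipE: "exec Skip s t s'"
  and exec_WriteE: "exec (Write x i a) s t s'"
  and exec_SeqE: "exec (Seq p q) s t s'"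
  and exec_CondE: "exec (Cond b p q) s t s'"
  and exec_LoopE: "exec (Loop b p) s t s'"

lemma exec_deterministic:
  "exec p s t s' \<Longrightarrow> exec p s u s'' \<Longrightarrow> u = t \<and> s'' = s'"
proof (induction arbitrary: u s'' rule: exec.induct)
  case (Skip s)
  then show ?case by (rule exec_SkipE) simp
next
  case (Write x i a s)
  then show ?case by (rule exec_WriteE) simp
next
  case Seq
  from Seq.prems show ?case by (rule exec_SeqE) (metis Seq.IH)
next
  case CondTrue
  from CondTrue.prems show ?case by (rule exec_CondE) (use CondTrue.hyps CondTrue.IH in fastforce)+
next
  case CondFalse
  from CondFalse.prems show ?case by (rule exec_CondE) (use CondFalse.hyps CondFalse.IH in fastforce)+
next
  case LoopFalse
  from LoopFalse.prems show ?case by (rule exec_LoopE) (use LoopFalse.hyps in simp_all)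
next
  case LoopTrue
  from LoopTrue.prems show ?case by (rule exec_LoopE) (use LoopTrue.hyps LoopTrue.IH in fastforce)+
qed

definition empty_store :: store where
  "empty_store = (\<lambda>x i. 0)"

definition scalar :: "nat \<Rightarrow> nat \<Rightarrow> nat" where
  "scalar m = (\<lambda>i. 0)(0 := m)"

definition computable :: "(nat \<Rightarrow> nat) \<Rightarrow> bool" where
  "computable f \<longleftrightarrow>
     (\<exists>p. \<forall>m. \<exists>t s. exec p (empty_store(''in'' := scalar m)) t s \<and> s ''out'' 0 = f m)"

text \<open>
  Input of a graph \<open>G\<close> with vertices \<open>0, \<dots>, n - 1\<close> and a vertex set \<open>X\<close>: the number \<open>n\<close>, the
  adjacency matrix row by row (the entry for \<open>u\<close>, \<open>v\<close> at index \<open>u * n + v\<close>), and the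
  characteristic vector of \<open>X\<close>.
\<close>

definition graph_input :: "nat \<Rightarrow> nat pair_pre_digraph \<Rightarrow> nat set \<Rightarrow> store" where
  "graph_input n G X = empty_store(
     ''n'' := scalar n,
     ''adj'' := (\<lambda>i. of_bool ((i div n, i mod n) \<in> parcs G)),
     ''X'' := (\<lambda>v. of_bool (v \<in> X)))"

end

theory Submission
  imports Defs
begin

text \<open>
  Let \<open>w\<close> be a vertex adjacent to all other non-isolated vertices of the threshold graph
  \<open>G \<setminus> X\<close>, and \<open>w'\<close> a neighbor of it there. Coloring \<open>w\<close> and \<open>w'\<close> with two extra colors
  satisfies all non-isolated vertices of \<open>G \<setminus> X\<close> and spoils no other vertex. It remains to
  find a coloring with as few colors \<open>q\<close> as possible that satisfies the vertices of \<open>X\<close> and those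
  with all neighbors in \<open>X\<close>; then \<open>q \<le> \<chi>\<close>, and \<open>q \<le> 2d + 1\<close>. These vertices have at most
  \<open>d + 2\<^sup>d\<close> distinct neighborhoods, and only the number, capped at 2, of occurrences of each color
  in each of these matters. So colorings of the first \<open>i\<close> vertices fall into at most
  \<open>3 ^ ((d + 2\<^sup>d) q)\<close> classes, and a list of class representatives can be extended vertex by vertex.
\<close>

section \<open>Running time of structured programs\<close>

text \<open>The program never computes \<open>chi_cf G\<close>. It solves exactly a relaxation that
  ignores the unsafe vertices (those with a neighbor outside \<open>X\<close> that are themselves
  outside \<open>X\<close>); every CF-ON coloring is feasible for it, and the two extra colors make
  up the whole gap of 2. The relaxation is what allows a bound in terms of d: unsafe vertices can
  have arbitrarily many distinct neighborhoods even for d = 0, as in a complete graph.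

  Time is measured on a concrete machine, so every loop needs an explicit bound. All loops are
  charged against one number M; the program text contributes only a factor and, through its nesting
  depth, an exponent. The costliest quantity is the number of table rows, which grows by a bounded
  amount per vertex and hence is linear in the number n of vertices for fixed d. So M can be taken
  as n times a function of d, and a power of M separates into a function of d and a power of
  n.\<close>

fun vars :: "aexp \<Rightarrow> var set" where
  "vars (Num m) = {}"
| "vars (Read x i) = insert x (vars i)"
| "vars (Add a b) = vars a \<union> vars b"
| "vars (Sub a b) = vars a \<union> vars b"

fun written :: "com \<Rightarrow> var set" where
  "written Skip = {}"
| "written (Write x i a) = {x}"
| "written (Seq p q) = written p \<union> written q"
| "written (Cond b p q) = written p \<union> written q"
| "written (Loop b p) = written p"

fun depth :: "com \<Rightarrow> nat" where
  "depth Skip = 0"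
| "depth (Write x i a) = 0"
| "depth (Seq p q) = max (depth p) (depth q)"
| "depth (Cond b p q) = max (depth p) (depth q)"
| "depth (Loop b p) = depth p + 1"

text \<open>The guard of a \<open>Loop\<close> is counted twice, once for the iterations and once
  for the failing test at the end. \<open>Cond\<close> adds up both branches, so that the weight
  depends on the program text alone.\<close>

fun weight :: "com \<Rightarrow> nat" where
  "weight Skip = 1"
| "weight (Write x i a) = acost i + acost a + 1"
| "weight (Seq p q) = weight p + weight q"
| "weight (Cond b p q) = bcost b + weight p + weight q + 1"
| "weight (Loop b p) = weight p + 2 * bcost b + 2"

lemma exec_frame: "exec p s t s' \<Longrightarrow> x \<notin> written p \<Longrightarrow> s' x = s x"
  by (induction rule: exec.induct) auto

lemma aval_cong: "(\<And>x. x \<in> vars a \<Longrightarrow> s' x = s x) \<Longrightarrow> aval a s' = aval a s"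
  by (induction a) auto

text \<open>
  A program whose loops each make at most \<open>M\<close> iterations runs in time
  \<open>weight p * M ^ depth p\<close>. This separates the syntactic part of the running time from \<open>M\<close>.
\<close>

definition wp :: "nat \<Rightarrow> com \<Rightarrow> (store \<Rightarrow> bool) \<Rightarrow> store \<Rightarrow> bool" where
  "wp M p Q s \<longleftrightarrow> (\<exists>t s'. exec p s t s' \<and> t \<le> weight p * M ^ depth p \<and> Q s')"

lemma wp_conseq:
  assumes "wp M p Q s"
    and "\<And>s'. Q s' \<Longrightarrow> (\<And>x. x \<notin> written p \<Longrightarrow> s' x = s x) \<Longrightarrow> Q' s'"
  shows "wp M p Q' s"
  using assms exec_frame unfolding wp_def by metis

lemma wp_Skip: "Q s \<Longrightarrow> wp M Skip Q s"
  unfolding wp_def using exec.Skip by fastforce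

lemma wp_Write: "Q (s(x := (s x)(aval i s := aval a s))) \<Longrightarrow> wp M (Write x i a) Q s"
  unfolding wp_def using exec.Write by fastforce

lemma weight_mono:
  fixes M :: nat
  assumes "t \<le> w * M ^ k" "k \<le> m" "M \<ge> 1"
  shows "t \<le> w * M ^ m"
  using assms by (meson le_trans mult_le_mono2 power_increasing)

lemma wp_Seq:
  assumes "wp M p (wp M q Q) s" "M \<ge> 1"
  shows "wp M (Seq p q) Q s"
proof -
  obtain t s' u s'' where *: "exec p s t s'" "t \<le> weight p * M ^ depth p"
    "exec q s' u s''" "u \<le> weight q * M ^ depth q" "Q s''"
    using assms(1) unfolding wp_def by blast
  have "t \<le> weight p * M ^ depth (Seq p q)" "u \<le> weight q * M ^ depth (Seq p q)"
    using weight_mono[OF *(2) _ assms(2)] weight_mono[OF *(4) _ assms(2)] by simp_all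
  then have "t + u \<le> weight (Seq p q) * M ^ depth (Seq p q)"
    by (simp add: algebra_simps)
  then show ?thesis
    unfolding wp_def using exec.Seq[OF *(1,3)] *(5) by blast
qed

lemma wp_Cond:
  assumes T: "bval b s \<Longrightarrow> wp M p Q s" and F: "\<not> bval b s \<Longrightarrow> wp M q Q s" and M: "M \<ge> 1"
  shows "wp M (Cond b p q) Q s"
proof -
  let ?d = "depth (Cond b p q)"
  have b: "bcost b + 1 \<le> (bcost b + 1) * M ^ ?d"
    using mult_le_mono2[of 1 "M ^ ?d" "bcost b + 1"] M by simp
  show ?thesis
  proof (cases "bval b s")
    case True
    obtain t s' where *: "exec p s t s'" "t \<le> weight p * M ^ depth p" "Q s'"
      using T[OF True] unfolding wp_def by blast
    have "t \<le> weight p * M ^ ?d" using weight_mono[OF *(2) _ M] by simp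
    then have "bcost b + t + 1 \<le> weight (Cond b p q) * M ^ ?d"
      using b by (simp add: algebra_simps trans_le_add1)
    then show ?thesis unfolding wp_def using exec.CondTrue[OF True *(1)] *(3) by blast
  next
    case False
    obtain t s' where *: "exec q s t s'" "t \<le> weight q * M ^ depth q" "Q s'"
      using F[OF False] unfolding wp_def by blast
    have "t \<le> weight q * M ^ ?d" using weight_mono[OF *(2) _ M] by simp
    then have "bcost b + t + 1 \<le> weight (Cond b p q) * M ^ ?d"
      using b by (simp add: algebra_simps trans_le_add1)
    then show ?thesis unfolding wp_def using exec.CondFalse[OF False *(1)] *(3) by blast
  qed
qed

section \<open>Scalar variables and counting loops\<close>

abbreviation V :: "var \<Rightarrow> aexp" where
  "V x \<equiv> Read x (Num 0)"

abbreviation Set :: "var \<Rightarrow> aexp \<Rightarrow> com" where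
  "Set x a \<equiv> Write x (Num 0) a"

definition set_var :: "var \<Rightarrow> nat \<Rightarrow> store \<Rightarrow> store" where
  "set_var x m s = s(x := (s x)(0 := m))"

lemma set_var_simps [simp]:
  "set_var x m s x 0 = m"
  "y \<noteq> x \<Longrightarrow> set_var x m s y = s y"
  "i \<noteq> 0 \<Longrightarrow> set_var x m s x i = s x i"
  by (simp_all add: set_var_def)

lemma wp_Set: "Q (set_var x (aval a s) s) \<Longrightarrow> wp M (Set x a) Q s"
  by (rule wp_Write) (simp add: set_var_def)

definition For :: "var \<Rightarrow> aexp \<Rightarrow> com \<Rightarrow> com" where
  "For x b p = Seq (Set x (Num 0)) (Loop (Less (V x) b) (Seq p (Set x (Add (V x) (Num 1)))))"

lemma written_For [simp]: "written (For x b p) = insert x (written p)"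
  by (auto simp: For_def)

text \<open>The body changes neither the counter nor the bound, so the bound has the same value at
  every test and there are exactly \<open>aval b s\<close> iterations. The frame premises in
  \<open>step\<close> and \<open>final\<close> let an invariant mention only what the body
  modifies.\<close>

lemma wp_For:
  assumes M: "aval b s \<le> M" "1 \<le> M"
    and x: "x \<notin> written p" and b: "vars b \<inter> insert x (written p) = {}"
    and init: "I 0 (set_var x 0 s)"
    and step: "\<And>i s'. \<lbrakk>i < aval b s; s' x 0 = i; I i s';
        \<And>y. y \<notin> insert x (written p) \<Longrightarrow> s' y = s y\<rbrakk>
      \<Longrightarrow> wp M p (\<lambda>s''. I (Suc i) (set_var x (Suc i) s'')) s'"
    and final: "\<And>s'. \<lbrakk>I (aval b s) s'; \<And>y. y \<notin> insert x (written p) \<Longrightarrow> s' y = s y\<rbrakk> \<Longrightarrow> Q s'"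
  shows "wp M (For x b p) Q s"
proof -
  let ?N = "aval b s"
  let ?b = "Less (V x) b" and ?p = "Seq p (Set x (Add (V x) (Num 1)))"
  \<comment> \<open>One iteration consists of the guard, the body, the increment of \<open>x\<close>
    at cost 6, and 1 for the loop step.\<close>
  let ?c = "weight p + bcost ?b + 7"
  let ?m = "M ^ depth p"
  let ?frame = "\<lambda>s'. \<forall>y. y \<notin> insert x (written p) \<longrightarrow> s' y = s y"
  have m: "1 \<le> ?m" using M(2) by simp
  have bval: "bval ?b s' \<longleftrightarrow> i < ?N" if "s' x 0 = i" "?frame s'" for s' i
  proof -
    have "aval b s' = aval b s"
      by (rule aval_cong) (use b that(2) in auto)
    then show ?thesis using that(1) by simp
  qed
  have loop: "\<exists>t s''. exec (Loop ?b ?p) s' t s'' \<and> t \<le> (?N - i) * (?c * ?m) + bcost ?b + 1 \<and> I ?N s'' \<and> ?frame s''"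
    if "i \<le> ?N" "s' x 0 = i" "I i s'" "?frame s'" for i s'
    using that
  proof (induction "?N - i" arbitrary: i s')
    case 0
    then have "\<not> bval ?b s'" "i = ?N" using bval[of s' i] by auto
    then show ?case using 0 exec.LoopFalse by (intro exI conjI) (assumption | simp)+
  next
    case (Suc k)
    then have i: "i < ?N" by simp
    obtain t1 s1 where 1: "exec p s' t1 s1" "t1 \<le> weight p * ?m" "I (Suc i) (set_var x (Suc i) s1)"
      using step[OF i Suc.prems(2,3)] Suc.prems(4) unfolding wp_def by blast
    have fr1: "y \<notin> written p \<Longrightarrow> s1 y = s' y" for y
      using exec_frame[OF 1(1)] by simp
    have "s1 x 0 = i" using fr1[OF x] Suc.prems(2) by simp
    then have e2: "exec (Set x (Add (V x) (Num 1))) s1 6 (set_var x (Suc i) s1)"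
      using exec.Write[of x "Num 0" "Add (V x) (Num 1)" s1] by (simp add: set_var_def eval_nat_numeral)
    have fr2: "?frame (set_var x (Suc i) s1)" using fr1 Suc.prems(4) by auto
    have "k = ?N - Suc i" using Suc.hyps(2) by simp
    from Suc.hyps(1)[OF this _ _ 1(3) fr2] i
    obtain u s'' where 2: "exec (Loop ?b ?p) (set_var x (Suc i) s1) u s''"
      "u \<le> (?N - Suc i) * (?c * ?m) + bcost ?b + 1" "I ?N s''" "?frame s''"
      by (metis Suc_leI set_var_simps(1))
    have "exec (Loop ?b ?p) s' (bcost ?b + (t1 + 6) + u + 1) s''"
      using exec.LoopTrue[OF _ exec.Seq[OF 1(1) e2] 2(1)] bval[of s' i] Suc.prems(2,4) i by blast
    moreover have "bcost ?b + (t1 + 6) + u + 1 \<le> (?N - i) * (?c * ?m) + bcost ?b + 1"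
    proof -
      have "bcost ?b + 7 \<le> (bcost ?b + 7) * ?m" using m by simp
      then have "bcost ?b + (t1 + 6) + 1 \<le> ?c * ?m"
        using 1(2) by (simp only: add_mult_distrib)
      moreover have "?N - i = Suc (?N - Suc i)" using i by simp
      ultimately show ?thesis using 2(2) by (simp only: mult_Suc)
    qed
    ultimately show ?case using 2(3,4) by blast
  qed
  obtain t s' where l: "exec (Loop ?b ?p) (set_var x 0 s) t s'"
    "t \<le> ?N * (?c * ?m) + bcost ?b + 1" "I ?N s'" "?frame s'"
    using loop[of 0 "set_var x 0 s"] init by auto
  have "exec (Set x (Num 0)) s 3 (set_var x 0 s)"
    using exec.Write[of x "Num 0" "Num 0" s] by (simp add: set_var_def eval_nat_numeral)
  then have e: "exec (For x b p) s (3 + t) s'"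
    unfolding For_def using l(1) by (rule exec.Seq)
  have d: "depth (For x b p) = depth p + 1"
    by (simp add: For_def)
  have w: "weight (For x b p) = ?c + bcost ?b + 4"
    by (simp add: For_def)
  have "?N * (?c * ?m) \<le> ?c * (M * ?m)"
    using M(1) by simp
  moreover have "bcost ?b + 4 \<le> (bcost ?b + 4) * (M * ?m)"
  proof -
    have "1 \<le> M * ?m" using M(2) m by (simp add: Suc_leI)
    then have "(bcost ?b + 4) * 1 \<le> (bcost ?b + 4) * (M * ?m)" by (rule mult_le_mono2)
    then show ?thesis by simp
  qed
  ultimately have "3 + t \<le> (?c + (bcost ?b + 4)) * (M * ?m)"
    using l(2) unfolding add_mult_distrib[of ?c] by linarith
  then have "3 + t \<le> weight (For x b p) * M ^ depth (For x b p)"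
    unfolding d w by (simp only: add.assoc power_add power_one_right mult.commute)
  then show ?thesis
    unfolding wp_def using e final[of s'] l(3,4) by blast
qed

text \<open>The bounded quantifier of the programs: a positive count expresses existence, and a
  count of 0 over counterexamples a universal statement. The body \<open>p\<close> computes what the
  test \<open>c\<close> needs.\<close>

definition Count :: "var \<Rightarrow> var \<Rightarrow> aexp \<Rightarrow> com \<Rightarrow> bexp \<Rightarrow> com" where
  "Count r x b p c =
     Seq (Set r (Num 0)) (For x b (Seq p (Cond c (Set r (Add (V r) (Num 1))) Skip)))"

lemma written_Count [simp]: "written (Count r x b p c) = {r, x} \<union> written p"
  by (auto simp: Count_def)

lemma wp_Count:
  assumes M: "aval b s \<le> M" "1 \<le> M"
    and x: "x \<noteq> r" "x \<notin> written p" "r \<notin> written p" and b: "vars b \<inter> ({r, x} \<union> written p) = {}"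
    and test: "\<And>i s'. \<lbrakk>i < aval b s; s' x 0 = i; \<And>y. y \<notin> {r, x} \<union> written p \<Longrightarrow> s' y = s y\<rbrakk>
      \<Longrightarrow> wp M p (\<lambda>s''. bval c s'' \<longleftrightarrow> P i) s'"
    and final: "\<And>s'. \<lbrakk>s' r 0 = card {i. i < aval b s \<and> P i};
        \<And>y. y \<notin> {r, x} \<union> written p \<Longrightarrow> s' y = s y\<rbrakk> \<Longrightarrow> Q s'"
  shows "wp M (Count r x b p c) Q s"
proof -
  have b': "aval b (set_var r 0 s) = aval b s"
    by (rule aval_cong, rule set_var_simps) (use b in auto)
  have card_Suc: "card {j. j < Suc i \<and> P j} = (if P i then Suc (card {j. j < i \<and> P j}) else card {j. j < i \<and> P j})" for i
  proof (cases "P i")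
    case True
    then have "{j. j < Suc i \<and> P j} = insert i {j. j < i \<and> P j}" by (auto simp: less_Suc_eq)
    then show ?thesis using True by simp
  next
    case False
    then have "{j. j < Suc i \<and> P j} = {j. j < i \<and> P j}" by (auto simp: less_Suc_eq)
    then show ?thesis using False by simp
  qed
  show ?thesis
    unfolding Count_def
  proof (intro wp_Seq wp_Set wp_For[where I = "\<lambda>i s'. s' r 0 = card {j. j < i \<and> P j}"])
    fix i s'
    assume A: "i < aval b (set_var r (aval (Num 0) s) s)" "s' x 0 = i" "s' r 0 = card {j. j < i \<and> P j}"
      "\<And>y. y \<notin> insert x (written (Seq p (Cond c (Set r (Add (V r) (Num 1))) Skip)))
        \<Longrightarrow> s' y = set_var r (aval (Num 0) s) s y"
    have "wp M p (\<lambda>s''. bval c s'' \<longleftrightarrow> P i) s'"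
      using A(1,2,4) b' by (intro test) auto
    then show "wp M p (wp M (Cond c (Set r (Add (V r) (Num 1))) Skip)
        (\<lambda>s''. set_var x (Suc i) s'' r 0 = card {j. j < Suc i \<and> P j})) s'"
    proof (rule wp_conseq)
      fix s'' assume B: "bval c s'' \<longleftrightarrow> P i" "\<And>x. x \<notin> written p \<Longrightarrow> s'' x = s' x"
      show "wp M (Cond c (Set r (Add (V r) (Num 1))) Skip)
        (\<lambda>s''. set_var x (Suc i) s'' r 0 = card {j. j < Suc i \<and> P j}) s''"
        by (intro wp_Cond wp_Set wp_Skip M(2)) (use A(3) B x in \<open>simp_all add: card_Suc\<close>)
    qed
  next
    fix s'
    assume A: "s' r 0 = card {j. j < aval b (set_var r (aval (Num 0) s) s) \<and> P j}"
      "\<And>y. y \<notin> insert x (written (Seq p (Cond c (Set r (Add (V r) (Num 1))) Skip)))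
        \<Longrightarrow> s' y = set_var r (aval (Num 0) s) s y"
    show "Q s'"
      using A b' by (intro final) auto
  qed (use M x b b' in auto)
qed

definition Eq :: "aexp \<Rightarrow> aexp \<Rightarrow> bexp" where
  "Eq a b = Conj (Neg (Less a b)) (Neg (Less b a))"

lemma bval_Eq [simp]: "bval (Eq a b) s \<longleftrightarrow> aval a s = aval b s"
  by (auto simp: Eq_def)

text \<open>The result is copied back to \<open>''in''\<close> so that running the program twice
  yields a double exponential.\<close>

definition Exp2 :: com where
  "Exp2 = Seq (Set ''out'' (Num 1)) (Seq
     (For ''i'' (V ''in'') (Set ''out'' (Add (V ''out'') (V ''out''))))
     (Set ''in'' (V ''out'')))"

lemma wp_Exp2:
  assumes M: "s ''in'' 0 \<le> M" "1 \<le> M"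
    and Q: "\<And>s'. s' ''in'' 0 = 2 ^ s ''in'' 0 \<Longrightarrow> s' ''out'' 0 = 2 ^ s ''in'' 0 \<Longrightarrow> Q s'"
  shows "wp M Exp2 Q s"
  unfolding Exp2_def
  by (intro wp_Seq wp_Set wp_For[where I = "\<lambda>i s'. s' ''out'' 0 = 2 ^ i"] Q) (use M in auto)

lemma computable_double_exp: "computable (\<lambda>m. 2 ^ 2 ^ (2 * m + c))"
proof -
  let ?p = "Seq (Set ''in'' (Add (Add (V ''in'') (V ''in'')) (Num c))) (Seq Exp2 Exp2)"
  have "\<exists>t s. exec ?p (empty_store(''in'' := scalar m)) t s \<and> s ''out'' 0 = 2 ^ 2 ^ (2 * m + c)" for m
  proof -
    \<comment> \<open>The first run iterates \<open>2 * m + c\<close> times, the second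
      \<open>2 ^ (2 * m + c)\<close> times; the larger number serves both. Only termination is used
      here.\<close>
    have "wp (2 ^ (2 * m + c)) ?p (\<lambda>s. s ''out'' 0 = 2 ^ 2 ^ (2 * m + c)) (empty_store(''in'' := scalar m))"
      by (intro wp_Seq wp_Set wp_Exp2) (auto simp: scalar_def mult_2 less_imp_le)
    then show ?thesis unfolding wp_def by blast
  qed
  then show ?thesis unfolding computable_def by blast
qed

section \<open>Threshold graphs and unique colors\<close>

lemma threshold_arcs_in_verts: "threshold G \<Longrightarrow> parcs G \<subseteq> pverts G \<times> pverts G"
  by (induction rule: threshold.induct) auto

text \<open>The witness is the universal vertex added last: vertices added after it are isolated,
  and those are exempt.\<close>

lemma threshold_dominating:
  assumes "threshold G" "parcs G \<noteq> {}"
  obtains w where "nbhd G w \<noteq> {}" "\<And>v. v \<noteq> w \<Longrightarrow> nbhd G v \<noteq> {} \<Longrightarrow> (w, v) \<in> parcs G"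
proof -
  have "\<exists>w. nbhd G w \<noteq> {} \<and> (\<forall>v. v \<noteq> w \<longrightarrow> nbhd G v \<noteq> {} \<longrightarrow> (w, v) \<in> parcs G)"
    using assms
  proof (induction rule: threshold.induct)
    case (universal G v)
    obtain u where u: "u \<in> pverts G"
      using universal.hyps(1) by (induction rule: threshold.induct) auto
    show ?case
      using u threshold_arcs_in_verts[OF universal.hyps(1)]
      by (intro exI[of _ v]) (auto simp: nbhd_def)
  qed (auto simp: nbhd_def)
  then show ?thesis using that by blast
qed

definition safe :: "'a pair_pre_digraph \<Rightarrow> 'a set \<Rightarrow> 'a \<Rightarrow> bool" where
  "safe G X v \<longleftrightarrow> v \<in> X \<or> nbhd G v \<subseteq> X"

lemma unsafe_iff: "\<not> safe G X v \<longleftrightarrow> nbhd (delete_verts G X) v \<noteq> {}"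
  by (auto simp: safe_def nbhd_def delete_verts_def)

lemma has_unique_colorI:
  "u \<in> U \<Longrightarrow> (\<And>v. v \<in> U \<Longrightarrow> C v = C u \<Longrightarrow> v = u) \<Longrightarrow> has_unique_color C U"
  unfolding has_unique_color_def by (intro exI[of _ "C u"]) (auto simp: card_1_singleton_iff)

lemma has_unique_colorE:
  assumes "has_unique_color C U"
  obtains u where "u \<in> U" "\<And>v. v \<in> U \<Longrightarrow> C v = C u \<Longrightarrow> v = u"
proof -
  obtain c u where u: "{v \<in> U. C v = c} = {u}"
    using assms unfolding has_unique_color_def One_nat_def card_1_singleton_iff by blast
  have iff: "v \<in> U \<and> C v = c \<longleftrightarrow> v = u" for v
    using arg_cong[OF u, of "\<lambda>A. v \<in> A"] by simp
  show ?thesis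
  proof (rule that)
    show "u \<in> U" using iff[of u] by simp
    show "v = u" if "v \<in> U" "C v = C u" for v
      using iff[of u] iff[of v] that by simp
  qed
qed

text \<open>Splitting color classes keeps a singleton class a singleton. This translates between
  colors counted from 0 in the search and from 1 in \<open>cf_on_coloring\<close>.\<close>

lemma has_unique_color_refine:
  assumes "has_unique_color C U" "\<And>u v. u \<in> U \<Longrightarrow> v \<in> U \<Longrightarrow> C' u = C' v \<Longrightarrow> C u = C v"
  shows "has_unique_color C' U"
proof -
  obtain u where u: "u \<in> U" "\<And>v. v \<in> U \<Longrightarrow> C v = C u \<Longrightarrow> v = u"
    using has_unique_colorE[OF assms(1)] by blast
  show ?thesis
    by (rule has_unique_colorI[OF u(1)]) (use u assms(2) in blast)
qed

text \<open>If the uniquely colored vertex is itself recolored, its new color does not occur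
  elsewhere in \<open>U\<close>; otherwise its own class gains no vertex.\<close>

lemma has_unique_color_fun_upd:
  assumes "has_unique_color C U" "\<And>v. v \<in> U \<Longrightarrow> C v \<noteq> c"
  shows "has_unique_color (C(w := c)) U"
proof -
  obtain u where "u \<in> U" "\<And>v. v \<in> U \<Longrightarrow> C v = C u \<Longrightarrow> v = u"
    using has_unique_colorE[OF assms(1)] by blast
  then show ?thesis
    using assms(2) by (intro has_unique_colorI[of u]) (auto split: if_splits)
qed

section \<open>Few colors for the safe vertices, two more for the others\<close>

context pair_graph
begin

lemma arc_sym: "(u, v) \<in> parcs G \<Longrightarrow> (v, u) \<in> parcs G"
  using pair_sym_arcs by (simp add: symmetric_def sym_def)

lemma nbhd_nonempty:
  assumes "Digraph_Component.connected (with_proj G)" "card (pverts G) \<ge> 2" "v \<in> pverts G"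
  shows "nbhd G v \<noteq> {}"
proof -
  obtain u where u: "u \<in> pverts G" "u \<noteq> v"
    using assms(2) card_mono[of "{v}" "pverts G"] by fastforce
  have "v \<rightarrow>\<^sup>*\<^bsub>mk_symmetric (with_proj G)\<^esub> u"
    using assms(1,3) u(1) by (auto simp: connected_def strongly_connected_def)
  then obtain w where "v \<rightarrow>\<^bsub>mk_symmetric (with_proj G)\<^esub> w"
    using u(2) by (metis pre_digraph.converse_reachable_cases)
  then have "(v, w) \<in> parcs G \<or> (w, v) \<in> parcs G"
    by (auto simp: mk_symmetric_def)
  then have "w \<in> nbhd G v"
    using arc_sym[of w v] by (auto simp: nbhd_def)
  then show ?thesis by blast
qed

text \<open>A neighbor \<open>u x\<close> is chosen for each \<open>x\<close> in \<open>X\<close>.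
  The vertices of \<open>X\<close> and the chosen ones, at most \<open>2 * card X\<close> in all,
  get distinct colors, and the remaining vertices share one more. Then \<open>x\<close> sees the
  color of \<open>u x\<close> once, and a safe vertex outside \<open>X\<close> sees some vertex of
  \<open>X\<close>, whose color is unique as well.\<close>

lemma exists_coloring_safe:
  assumes ne: "\<And>v. v \<in> pverts G \<Longrightarrow> nbhd G v \<noteq> {}" and X: "X \<subseteq> pverts G"
  shows "\<exists>C. (\<forall>v. C v < 2 * card X + 1) \<and> (\<forall>v\<in>pverts G. safe G X v \<longrightarrow> has_unique_color C (nbhd G v))"
proof -
  have "\<forall>x\<in>X. \<exists>y. y \<in> nbhd G x" using ne X by blast
  from bchoice[OF this] obtain u where u: "\<forall>x\<in>X. u x \<in> nbhd G x" ..
  let ?W = "X \<union> u ` X"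
  have fin: "finite X" using X pair_finite_verts finite_subset by blast
  have "card ?W \<le> 2 * card X"
    using card_Un_le[of X "u ` X"] card_image_le[OF fin, of u] by linarith
  moreover obtain f :: "'a \<Rightarrow> nat" where f: "bij_betw f ?W {0..<card ?W}"
    using ex_bij_betw_finite_nat[of ?W] fin by blast
  ultimately have less: "f v < 2 * card X" if "v \<in> ?W" for v
    using bspec[OF bij_betwE[OF f] that] by simp
  have inj: "inj_on f ?W" using f by (rule bij_betw_imp_inj_on)
  define C where "C v = (if v \<in> ?W then f v else 2 * card X)" for v
  have uniq: "v = w" if "w \<in> ?W" "C v = C w" for v w
    using that less[of w] inj_onD[OF inj, of v w] by (auto simp: C_def split: if_splits)
  have "has_unique_color C (nbhd G v)" if v: "v \<in> pverts G" "safe G X v" for v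
  proof (cases "v \<in> X")
    case True
    then show ?thesis using u uniq by (intro has_unique_colorI[of "u v"]) auto
  next
    case False
    with v ne[OF v(1)] obtain w where "w \<in> nbhd G v" "w \<in> X" unfolding safe_def by blast
    then show ?thesis using uniq by (intro has_unique_colorI[of w]) auto
  qed
  moreover have "C v < 2 * card X + 1" for v using less[of v] by (auto simp: C_def)
  ultimately show ?thesis by blast
qed

text \<open>
  Giving new colors to a vertex \<open>w\<close> adjacent to all other unsafe vertices and to a neighbor of \<open>w\<close>
  satisfies all unsafe vertices, and a neighborhood with a unique color still has one, since the new
  colors are themselves unique. Hence \<open>w\<close> and \<open>w2\<close> may be arbitrary if all vertices are safe.
\<close>

lemma cf_on_coloring_extend:
  assumes C: "\<And>v. v \<in> pverts G \<Longrightarrow> C v \<in> {1..q}"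
    and S: "\<And>v. v \<in> pverts G \<Longrightarrow> safe G X v \<Longrightarrow> has_unique_color C (nbhd G v)"
    and w: "\<And>v. v \<in> pverts G \<Longrightarrow> \<not> safe G X v \<Longrightarrow> v \<noteq> w \<Longrightarrow> (w, v) \<in> parcs G"
    and w2: "\<And>v. v \<in> pverts G \<Longrightarrow> \<not> safe G X v \<Longrightarrow> w2 \<noteq> w \<and> (w, w2) \<in> parcs G"
  shows "cf_on_coloring G (q + 2) (C(w := q + 1, w2 := q + 2))"
  unfolding cf_on_coloring_def
proof (intro conjI ballI)
  let ?C = "C(w := q + 1, w2 := q + 2)"
  fix v assume v: "v \<in> pverts G"
  have n: "C u \<le> q" if "u \<in> nbhd G v" for u
    using C[of u] that in_arcsD2 by (auto simp: nbhd_def)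
  have n1: "C u \<noteq> q + 1" "(C(w := q + 1)) u \<noteq> q + 2" if "u \<in> nbhd G v" for u
    using n[OF that] by auto
  show "has_unique_color ?C (nbhd G v)"
  proof (cases "safe G X v")
    case True
    have "has_unique_color (C(w := q + 1)) (nbhd G v)"
      using S[OF v True] by (rule has_unique_color_fun_upd) (rule n1)
    then show ?thesis
      by (rule has_unique_color_fun_upd) (rule n1)
  next
    case False
    have ww: "w2 \<noteq> w" "(w, w2) \<in> parcs G" using w2[OF v False] by auto
    show ?thesis
    proof (cases "v = w")
      case True
      show ?thesis
        by (rule has_unique_colorI[of w2]) (use ww n True in \<open>auto simp: nbhd_def split: if_splits\<close>, force)
    next
      case F: False
      have "w \<in> nbhd G v" using w[OF v False F] arc_sym by (simp add: nbhd_def)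
      then show ?thesis
        by (rule has_unique_colorI) (use ww n in \<open>auto split: if_splits\<close>, force)
    qed
  qed
  show "?C v \<in> {1..q + 2}" using C[OF v] by auto
qed

end

section \<open>Partial colorings up to equivalence\<close>

definition occ :: "(nat \<Rightarrow> nat set) \<Rightarrow> (nat \<Rightarrow> nat) \<Rightarrow> nat \<Rightarrow> nat \<Rightarrow> nat \<Rightarrow> nat" where
  "occ N g i s c = card {v. v < i \<and> v \<in> N s \<and> g v = c}"

definition equiv_upto :: "(nat \<Rightarrow> nat set) \<Rightarrow> nat set \<Rightarrow> nat \<Rightarrow> nat \<Rightarrow> (nat \<Rightarrow> nat) \<Rightarrow> (nat \<Rightarrow> nat) \<Rightarrow> bool" where
  "equiv_upto N S q i g h \<longleftrightarrow> (\<forall>s\<in>S. \<forall>c<q. min 2 (occ N g i s c) = min 2 (occ N h i s c))"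

lemma occ_cong: "(\<And>v. v < i \<Longrightarrow> g v = h v) \<Longrightarrow> occ N g i s c = occ N h i s c"
  unfolding occ_def by (rule arg_cong[where f = card]) auto

lemma equiv_upto_cong:
  assumes "\<And>v. v < i \<Longrightarrow> g v = g' v" "\<And>v. v < i \<Longrightarrow> h v = h' v"
  shows "equiv_upto N S q i g h \<longleftrightarrow> equiv_upto N S q i g' h'"
  unfolding equiv_upto_def using occ_cong[of i g g' N] occ_cong[of i h h' N] assms by simp

lemma equiv_upto_refl: "equiv_upto N S q i g g"
  by (simp add: equiv_upto_def)

lemma equiv_upto_sym: "equiv_upto N S q i g h \<Longrightarrow> equiv_upto N S q i h g"
  by (simp add: equiv_upto_def)

lemma equiv_upto_trans:
  "equiv_upto N S q i g h \<Longrightarrow> equiv_upto N S q i h k \<Longrightarrow> equiv_upto N S q i g k"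
  by (simp add: equiv_upto_def)

lemma occ_Suc: "occ N g (Suc i) s c = occ N g i s c + (if i \<in> N s \<and> g i = c then 1 else 0)"
proof -
  have "{v. v < Suc i \<and> v \<in> N s \<and> g v = c} =
    {v. v < i \<and> v \<in> N s \<and> g v = c} \<union> (if i \<in> N s \<and> g i = c then {i} else {})"
    by (auto simp: less_Suc_eq)
  then show ?thesis by (simp add: occ_def)
qed

text \<open>A capped count after vertex \<open>i\<close> is determined by the capped count before it
  and the color of \<open>i\<close>, since a count of at least 2 remains so. Hence discarding all
  but one member of a class loses no extension.\<close>

lemma equiv_upto_Suc:
  assumes "equiv_upto N S q i g h" "g i = h i"
  shows "equiv_upto N S q (Suc i) g h"
proof -
  have min_Suc: "min 2 (Suc a) = min 2 (Suc b)" if "min 2 a = min 2 b" for a b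
    using that by (simp add: min_def split: if_splits)
  show ?thesis
    unfolding equiv_upto_def occ_Suc assms(2)
  proof (intro ballI allI impI)
    fix s c assume "s \<in> S" "c < q"
    then have "min 2 (occ N g i s c) = min 2 (occ N h i s c)"
      using assms(1) unfolding equiv_upto_def by blast
    then show "min 2 (occ N g i s c + (if i \<in> N s \<and> h i = c then 1 else 0)) =
      min 2 (occ N h i s c + (if i \<in> N s \<and> h i = c then 1 else 0))"
      using min_Suc by simp
  qed
qed

lemma card_inequivalent:
  assumes fin: "finite (N ` S)"
    and ineq: "\<And>g h. g \<in> R \<Longrightarrow> h \<in> R \<Longrightarrow> equiv_upto N S q i g h \<Longrightarrow> g = h"
  shows "finite R \<and> card R \<le> 3 ^ (card (N ` S) * q)"
proof -
  \<comment> \<open>The signature is indexed by neighborhoods instead of vertices: vertices with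
    equal neighborhoods have equal counts. This keeps the number of vertices in \<open>S\<close> out
    of the exponent.\<close>
  define F where "F g = (\<lambda>(A, c)\<in>N ` S \<times> {..<q}. min 2 (card {v. v < i \<and> v \<in> A \<and> g v = c}))"
    for g :: "nat \<Rightarrow> nat"
  let ?B = "PiE (N ` S \<times> {..<q}) (\<lambda>_. {..<3::nat})"
  have inj: "inj_on F R"
  proof (rule inj_onI, rule ineq)
    fix g h assume F: "F g = F h"
    show "equiv_upto N S q i g h"
      unfolding equiv_upto_def
    proof (intro ballI allI impI)
      fix s c assume "s \<in> S" "c < q"
      then show "min 2 (occ N g i s c) = min 2 (occ N h i s c)"
        using fun_cong[OF F, of "(N s, c)"] by (simp add: F_def occ_def)
    qed
  qed
  have sub: "F ` R \<subseteq> ?B"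
    unfolding F_def by (intro image_subsetI restrict_PiE_iff[THEN iffD2]) auto
  have finB: "finite ?B" using fin by (intro finite_PiE) auto
  have "card ?B = 3 ^ (card (N ` S) * q)"
    using fin by (simp add: card_PiE card_cartesian_product)
  then show ?thesis
    using card_inj_on_le[OF inj sub finB] inj_on_finite[OF inj sub finB] by simp
qed

text \<open>Each vertex of \<open>X\<close> contributes one neighborhood, and the neighborhood of
  any other safe vertex is a subset of \<open>X\<close>.\<close>

lemma card_safe_nbhds:
  assumes "finite X" "S \<subseteq> {v. safe G X v}"
  shows "finite (nbhd G ` S) \<and> card (nbhd G ` S) \<le> card X + 2 ^ card X"
proof -
  have sub: "nbhd G ` S \<subseteq> nbhd G ` X \<union> Pow X"
    using assms(2) by (auto simp: safe_def)
  have "card (nbhd G ` X \<union> Pow X) \<le> card (nbhd G ` X) + card (Pow X)"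
    by (rule card_Un_le)
  also have "\<dots> \<le> card X + 2 ^ card X"
    using card_image_le[OF assms(1), of "nbhd G"] by (simp add: card_Pow assms(1))
  finally show ?thesis
    using sub assms(1) card_mono[OF _ sub] finite_subset[OF sub] by auto
qed

section \<open>Tables of representatives\<close>

definition inequiv :: "(nat \<Rightarrow> nat set) \<Rightarrow> nat set \<Rightarrow> nat \<Rightarrow> nat \<Rightarrow> (nat \<Rightarrow> nat \<Rightarrow> nat) \<Rightarrow> nat \<Rightarrow> nat \<Rightarrow> bool" where
  "inequiv N S q i R a b \<longleftrightarrow>
     (\<forall>r\<in>{a..<b}. \<forall>v<i. R r v < q) \<and>
     (\<forall>r\<in>{a..<b}. \<forall>r'\<in>{a..<b}. equiv_upto N S q i (R r) (R r') \<longrightarrow> r = r')"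

definition reps :: "(nat \<Rightarrow> nat set) \<Rightarrow> nat set \<Rightarrow> nat \<Rightarrow> nat \<Rightarrow> (nat \<Rightarrow> nat \<Rightarrow> nat) \<Rightarrow> nat \<Rightarrow> nat \<Rightarrow> bool" where
  "reps N S q i R a b \<longleftrightarrow> inequiv N S q i R a b \<and>
     (\<forall>g. (\<forall>v<i. g v < q) \<longrightarrow> (\<exists>r\<in>{a..<b}. equiv_upto N S q i g (R r)))"

text \<open>\<open>D\<close> collects the pairs of an old row and a color already processed by the
  nested loops. Once it contains all pairs, \<open>reps_Suc\<close> applies.\<close>

definition covers :: "(nat \<Rightarrow> nat set) \<Rightarrow> nat set \<Rightarrow> nat \<Rightarrow> nat \<Rightarrow> (nat \<Rightarrow> nat \<Rightarrow> nat) \<Rightarrow> nat \<Rightarrow> nat \<Rightarrow> (nat \<times> nat) set \<Rightarrow> bool" where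
  "covers N S q i R b e D \<longleftrightarrow>
     (\<forall>r c. (r, c) \<in> D \<longrightarrow> (\<exists>g\<in>{b..<e}. equiv_upto N S q (Suc i) ((R r)(i := c)) (R g)))"

lemma inequiv_cong:
  assumes "\<And>r v. r < b \<Longrightarrow> v < i \<Longrightarrow> R' r v = R r v" "inequiv N S q i R a b"
  shows "inequiv N S q i R' a b"
proof -
  have "equiv_upto N S q i (R r) (R r')" if "r < b" "r' < b" "equiv_upto N S q i (R' r) (R' r')" for r r'
    using that assms(1) equiv_upto_cong[of i "R' r" "R r" "R' r'" "R r'"] by simp
  then show ?thesis
    using assms unfolding inequiv_def by (metis atLeastLessThan_iff)
qed

lemma reps_cong:
  assumes "\<And>r v. r < b \<Longrightarrow> v < i \<Longrightarrow> R' r v = R r v" "reps N S q i R a b"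
  shows "reps N S q i R' a b"
proof -
  have "equiv_upto N S q i g (R' r)" if "r < b" "equiv_upto N S q i g (R r)" for r g
    using that assms(1) equiv_upto_cong[of i g g "R' r" "R r"] by simp
  then show ?thesis
    using assms inequiv_cong[of b i R' R] unfolding reps_def by (metis atLeastLessThan_iff)
qed

text \<open>All colorings of no vertices are equivalent, so a single row with arbitrary content
  represents them and the table needs no initialization.\<close>

lemma reps_0: "reps N S q 0 R 0 1"
  by (auto simp: reps_def inequiv_def equiv_upto_def occ_def)

lemma inequiv_bound:
  assumes "finite (N ` S)" "inequiv N S q i R a b"
  shows "b - a \<le> 3 ^ (card (N ` S) * q)"
proof -
  have "inj_on R {a..<b}"
    using assms(2) equiv_upto_refl unfolding inequiv_def inj_on_def by metis
  then have "card (R ` {a..<b}) = b - a" by (simp add: card_image)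
  moreover have "card (R ` {a..<b}) \<le> 3 ^ (card (N ` S) * q)"
    using assms(2) by (intro conjunct2[OF card_inequivalent[OF assms(1), of _ q i]]) (auto simp: inequiv_def)
  ultimately show ?thesis by simp
qed

text \<open>The restriction of \<open>g\<close> to the first \<open>i\<close> vertices may be
  exchanged for its representative; extending the latter by the color \<open>g i\<close> gives a
  processed pair, whose class is present.\<close>

lemma reps_Suc:
  assumes reps: "reps N S q i R a b" and new: "inequiv N S q (Suc i) R b e"
    and cov: "covers N S q i R b e ({a..<b} \<times> {..<q})"
  shows "reps N S q (Suc i) R b e"
  unfolding reps_def
proof (intro conjI new allI impI)
  fix g assume g: "\<forall>v<Suc i. g v < q"
  then have "\<forall>v<i. g v < q" by simp
  then obtain r where r: "r \<in> {a..<b}" "equiv_upto N S q i g (R r)"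
    using reps unfolding reps_def by blast
  have "equiv_upto N S q i g ((R r)(i := g i))"
    using r(2) equiv_upto_cong[of i g g "R r" "(R r)(i := g i)"] by simp
  then have 1: "equiv_upto N S q (Suc i) g ((R r)(i := g i))"
    by (rule equiv_upto_Suc) simp
  have "(r, g i) \<in> {a..<b} \<times> {..<q}" using r(1) g by simp
  then obtain h where "h \<in> {b..<e}" "equiv_upto N S q (Suc i) ((R r)(i := g i)) (R h)"
    using cov unfolding covers_def by blast
  then show "\<exists>r\<in>{b..<e}. equiv_upto N S q (Suc i) g (R r)"
    using equiv_upto_trans[OF 1] by blast
qed

text \<open>A candidate is always written to row \<open>e\<close>, but \<open>e\<close> advances
  only if no new row is equivalent to it. \<open>R\<close> and \<open>R'\<close> are the tables
  before and after the writing; they need to agree only where colors are already assigned.\<close>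

lemma extend_step:
  assumes reps: "reps N S q i R a b" and new: "inequiv N S q (Suc i) R b e"
    and cov: "covers N S q i R b e D" and be: "b \<le> e"
    and r: "r \<in> {a..<b}" and c: "c < q" and D: "D \<subseteq> {a..<b} \<times> {..<q}"
    and old: "\<And>r v. r < e \<Longrightarrow> v < Suc i \<Longrightarrow> R' r v = R r v"
    and ext: "\<And>v. v < Suc i \<Longrightarrow> R' e v = ((R r)(i := c)) v"
    and e': "e' = (if \<exists>g\<in>{b..<e}. equiv_upto N S q (Suc i) (R' g) (R' e) then e else Suc e)"
  shows "reps N S q i R' a b \<and> inequiv N S q (Suc i) R' b e' \<and> covers N S q i R' b e' (insert (r, c) D)"
proof -
  let ?eq = "equiv_upto N S q (Suc i)"
  have reps': "reps N S q i R' a b"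
    by (rule reps_cong[OF _ reps]) (use old be in auto)
  have new': "inequiv N S q (Suc i) R' b e"
    by (rule inequiv_cong[OF old new])
  have "\<exists>g\<in>{b..<e}. ?eq ((R' r')(i := c')) (R' g)" if rc: "(r', c') \<in> D" for r' c'
  proof -
    obtain g where g: "g \<in> {b..<e}" "?eq ((R r')(i := c')) (R g)"
      using cov rc unfolding covers_def by blast
    have "r' < e" using rc D be by auto
    then have "?eq ((R' r')(i := c')) (R' g)"
      using g equiv_upto_cong[of "Suc i" "(R' r')(i := c')" "(R r')(i := c')" "R' g" "R g"] old by simp
    then show ?thesis using g(1) by blast
  qed
  then have cov': "covers N S q i R' b e D" unfolding covers_def by blast
  have "r < e" using r be by simp
  \<comment> \<open>Row \<open>e\<close> and the extended row \<open>r\<close> may differ beyond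
    vertex \<open>i\<close>, but the equivalence does not look further.\<close>
  then have ext': "?eq ((R' r)(i := c)) h \<longleftrightarrow> ?eq (R' e) h" for h
    using equiv_upto_cong[of "Suc i" "(R' r)(i := c)" "R' e" h h] old ext by simp
  show ?thesis
  proof (cases "\<exists>g\<in>{b..<e}. ?eq (R' g) (R' e)")
    case True
    then obtain g where "g \<in> {b..<e}" "?eq ((R' r)(i := c)) (R' g)"
      using ext' equiv_upto_sym by blast
    then have "covers N S q i R' b e (insert (r, c) D)"
      using cov' unfolding covers_def by blast
    then show ?thesis using e' True reps' new' by simp
  next
    case False
    have "R' e v < q" if "v < Suc i" for v
      using that ext[OF that] c reps r unfolding reps_def inequiv_def
      by (auto simp: less_Suc_eq)
    then have "inequiv N S q (Suc i) R' b (Suc e)"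
      using new' False equiv_upto_sym unfolding inequiv_def by (metis atLeastLessThanSuc atLeastLessThan_empty be
          empty_iff insert_iff not_less_eq_eq)
    moreover have "covers N S q i R' b (Suc e) (insert (r, c) D)"
      using cov' ext' equiv_upto_refl[of N S q "Suc i" "R' e"] be unfolding covers_def
      by (fastforce simp: less_Suc_eq)
    ultimately show ?thesis using e' False reps' by simp
  qed
qed

definition good :: "(nat \<Rightarrow> nat set) \<Rightarrow> nat set \<Rightarrow> nat \<Rightarrow> nat \<Rightarrow> (nat \<Rightarrow> nat) \<Rightarrow> bool" where
  "good N S q n g \<longleftrightarrow> (\<forall>s\<in>S. \<exists>c<q. occ N g n s c = 1)"

lemma good_equiv:
  assumes "equiv_upto N S q n g h" "good N S q n g"
  shows "good N S q n h"
proof -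
  have "occ N h n s c = 1" if "s \<in> S" "c < q" "occ N g n s c = 1" for s c
  proof -
    have "min 2 (occ N g n s c) = min 2 (occ N h n s c)"
      using assms(1) that unfolding equiv_upto_def by blast
    then show ?thesis using that(3) by (simp add: min_def split: if_splits)
  qed
  then show ?thesis using assms(2) unfolding good_def by metis
qed

lemma good_iff_unique_color:
  assumes N: "\<And>s. s \<in> S \<Longrightarrow> N s \<subseteq> {..<n}" and g: "\<And>v. v < n \<Longrightarrow> g v < q"
  shows "good N S q n g \<longleftrightarrow> (\<forall>s\<in>S. has_unique_color g (N s))"
proof -
  have "(\<exists>c<q. occ N g n s c = 1) \<longleftrightarrow> has_unique_color g (N s)" if s: "s \<in> S" for s
  proof -
    have occ: "occ N g n s c = card {u \<in> N s. g u = c}" for c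
      unfolding occ_def using N[OF s] by (intro arg_cong[where f = card]) auto
    \<comment> \<open>\<open>has_unique_color\<close> does not bound the color, but a color that
      occurs once belongs to some vertex below \<open>n\<close>.\<close>
    have "c < q" if "card {u \<in> N s. g u = c} = 1" for c
    proof -
      have "{u \<in> N s. g u = c} \<noteq> {}" using that by (metis card.empty zero_neq_one)
      then show ?thesis using g N[OF s] by auto
    qed
    then show ?thesis unfolding has_unique_color_def occ by blast
  qed
  then show ?thesis unfolding good_def by simp
qed

section \<open>Programs\<close>

text \<open>
  Row \<open>r\<close> of the table \<open>''T''\<close> starts at index \<open>r * n\<close> and holds a partial coloring with colors
  \<open>0, \<dots>, q - 1\<close>. The machine has no multiplication, so the multiples of \<open>n\<close> are tabulated in
  \<open>''mul''\<close>. Rows \<open>a, \<dots>, b - 1\<close> represent the colorings of the first \<open>i\<close> vertices, rows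
  \<open>b, \<dots>, e - 1\<close> those found so far for the first \<open>i + 1\<close> vertices. \<open>''U''\<close> marks the vertices
  outside of \<open>S\<close>, which need not be satisfied. A nonzero \<open>''f''\<close> is the successor of the index of a
  row that solves the problem.
\<close>

definition rows :: "nat \<Rightarrow> store \<Rightarrow> nat \<Rightarrow> nat \<Rightarrow> nat" where
  "rows n s r v = s ''T'' (r * n + v)"

lemma row_index_eq_iff:
  fixes u v n :: nat
  assumes "u < n" "v < n"
  shows "r * n + u = r' * n + v \<longleftrightarrow> r = r' \<and> u = v"
proof
  assume *: "r * n + u = r' * n + v"
  have "(r * n + u) div n = r" "(r' * n + v) div n = r'" using assms by simp_all
  then show "r = r' \<and> u = v" using * by simp
qed simp

text \<open>The multiples of \<open>n\<close> are tabulated up to index \<open>m\<close>. Index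
  \<open>n\<close> is enough to address the adjacency matrix; addressing further rows of the color
  table requires further entries.\<close>

definition ctx :: "nat \<Rightarrow> nat \<Rightarrow> (nat \<Rightarrow> nat set) \<Rightarrow> nat set \<Rightarrow> nat \<Rightarrow> store \<Rightarrow> bool" where
  "ctx n q N S m s \<longleftrightarrow> s ''n'' 0 = n \<and> s ''q'' 0 = q \<and>
     (\<forall>u<n. \<forall>v<n. s ''adj'' (u * n + v) = of_bool (v \<in> N u)) \<and>
     (\<forall>u<n. s ''U'' u = of_bool (u \<notin> S)) \<and> (\<forall>r\<le>m. s ''mul'' r = r * n)"

lemma ctx_cong:
  assumes "\<And>y. y \<in> {''n'', ''q'', ''adj'', ''U'', ''mul''} \<Longrightarrow> s' y = s y"
  shows "ctx n q N S m s' = ctx n q N S m s"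
  unfolding ctx_def by (simp add: assms)

section \<open>Comparing two rows up to equivalence\<close>

definition Occ :: "var \<Rightarrow> var \<Rightarrow> aexp \<Rightarrow> com" where
  "Occ k r b = Count k ''v'' b Skip (Conj
     (Eq (Read ''adj'' (Add (Read ''mul'' (V ''s'')) (V ''v''))) (Num 1))
     (Eq (Read ''T'' (Add (Read ''mul'' (V r)) (V ''v''))) (V ''h'')))"

lemma written_Occ [simp]: "written (Occ k r b) = {k, ''v''}"
  by (auto simp: Occ_def)

lemma wp_Occ:
  assumes M: "n \<le> M" "1 \<le> M" and ctx: "ctx n q N S m s"
    and u: "s ''s'' 0 < n" "s r 0 \<le> m" "s ''s'' 0 \<le> m" and b: "aval b s \<le> n" "vars b \<inter> {k, ''v''} = {}"
    and k: "k \<notin> {''v'', ''s'', ''h'', ''adj'', ''mul'', ''T'', r}" "r \<noteq> ''v''"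
    and Q: "\<And>s'. s' k 0 = occ N (rows n s (s r 0)) (aval b s) (s ''s'' 0) (s ''h'' 0) \<Longrightarrow>
        (\<And>y. y \<notin> {k, ''v''} \<Longrightarrow> s' y = s y) \<Longrightarrow> Q s'"
  shows "wp M (Occ k r b) Q s"
  unfolding Occ_def
proof (rule wp_Count[where P = "\<lambda>v. v \<in> N (s ''s'' 0) \<and> rows n s (s r 0) v = s ''h'' 0"])
  fix v s'
  assume v: "v < aval b s" "s' ''v'' 0 = v" and fr: "\<And>y. y \<notin> {k, ''v''} \<union> written Skip \<Longrightarrow> s' y = s y"
  have "s' ''s'' = s ''s''" "s' ''h'' = s ''h''" "s' ''adj'' = s ''adj''" "s' ''mul'' = s ''mul''"
    "s' ''T'' = s ''T''" "s' r = s r"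
    using k fr by auto
  then show "wp M Skip (\<lambda>s''. bval (Conj
     (Eq (Read ''adj'' (Add (Read ''mul'' (V ''s'')) (V ''v''))) (Num 1))
     (Eq (Read ''T'' (Add (Read ''mul'' (V r)) (V ''v''))) (V ''h''))) s'' \<longleftrightarrow>
     v \<in> N (s ''s'' 0) \<and> rows n s (s r 0) v = s ''h'' 0) s'"
    using v u b(1) ctx by (intro wp_Skip) (auto simp: ctx_def rows_def)
next
  fix s'
  assume "s' k 0 = card {v. v < aval b s \<and> v \<in> N (s ''s'' 0) \<and> rows n s (s r 0) v = s ''h'' 0}"
    "\<And>y. y \<notin> {k, ''v''} \<union> written Skip \<Longrightarrow> s' y = s y"
  then show "Q s'" by (intro Q) (auto simp: occ_def)
qed (use M b k in auto)

text \<open>With truncated subtraction, \<open>k - (k - 2)\<close> is \<open>min 2 k\<close>.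
  \<open>''y''\<close> counts the colors whose capped counts differ at one vertex, and
  \<open>''z''\<close> counts the vertices of \<open>S\<close> with such a color, so 0 means
  equivalence.\<close>

definition Equiv :: com where
  "Equiv = Count ''z'' ''s'' (V ''n'')
     (Count ''y'' ''h'' (V ''q'')
        (Seq (Occ ''k'' ''g'' (Add (V ''i'') (Num 1))) (Occ ''l'' ''e'' (Add (V ''i'') (Num 1))))
        (Neg (Eq (Sub (V ''k'') (Sub (V ''k'') (Num 2))) (Sub (V ''l'') (Sub (V ''l'') (Num 2))))))
     (Conj (Eq (Read ''U'' (V ''s'')) (Num 0)) (Less (Num 0) (V ''y'')))"

lemma written_Equiv [simp]: "written Equiv = {''z'', ''s'', ''y'', ''h'', ''k'', ''l'', ''v''}"
  by (auto simp: Equiv_def)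

lemma wp_Equiv:
  assumes M: "n \<le> M" "1 \<le> M" "q \<le> M" and ctx: "ctx n q N S m s" and S: "S \<subseteq> {..<n}"
    and b: "s ''i'' 0 < n" "s ''g'' 0 \<le> m" "s ''e'' 0 \<le> m" "n \<le> m"
    and Q: "\<And>s'. s' ''z'' 0 = 0 \<longleftrightarrow> equiv_upto N S q (Suc (s ''i'' 0)) (rows n s (s ''g'' 0)) (rows n s (s ''e'' 0)) \<Longrightarrow>
        (\<And>y. y \<notin> written Equiv \<Longrightarrow> s' y = s y) \<Longrightarrow> Q s'"
  shows "wp M Equiv Q s"
proof -
  let ?i = "Suc (s ''i'' 0)" and ?g = "rows n s (s ''g'' 0)" and ?h = "rows n s (s ''e'' 0)"
  let ?diff = "\<lambda>u c. min 2 (occ N ?g ?i u c) \<noteq> min 2 (occ N ?h ?i u c)"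
  have n: "s ''n'' 0 = n" "s ''q'' 0 = q" using ctx by (auto simp: ctx_def)
  have capped: "a - (a - 2) = min 2 a" for a :: nat by simp
  show ?thesis
    unfolding Equiv_def
  proof (rule wp_Count[where P = "\<lambda>u. u \<in> S \<and> (\<exists>c<q. ?diff u c)"], goal_cases)
    case (7 u s1)
    then have u: "u < n" "s1 ''s'' 0 = u" and fr: "\<And>y. y \<notin> written Equiv \<Longrightarrow> s1 y = s y"
      by (auto simp: n)
    have ctx1: "ctx n q N S m s1" using ctx by (subst ctx_cong[OF fr]) auto
    show ?case
    proof (rule wp_Count[where P = "\<lambda>c. ?diff u c"], goal_cases)
      case (7 c s2)
      then have c: "c < q" "s2 ''h'' 0 = c" and fr2: "\<And>y. y \<notin> {''y'', ''h'', ''k'', ''l'', ''v''} \<Longrightarrow> s2 y = s1 y"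
        by (auto simp: n fr)
      have ctx2: "ctx n q N S m s2" using ctx1 by (subst ctx_cong[OF fr2]) auto
      have R2: "rows n s2 = rows n s" by (simp add: rows_def fun_eq_iff fr2 fr)
      show ?case
      proof (rule wp_Seq, rule wp_Occ[OF M(1,2) ctx2], goal_cases)
        case (8 s3)
        then have fr3: "\<And>y. y \<notin> {''k'', ''v''} \<Longrightarrow> s3 y = s2 y" by simp
        have ctx3: "ctx n q N S m s3" using ctx2 by (subst ctx_cong[OF fr3]) auto
        have R3: "rows n s3 = rows n s" by (simp add: rows_def fun_eq_iff fr3 fr2 fr)
        show ?case
          by (rule wp_Occ[OF M(1,2) ctx3])
            (use 8(1) b u c in \<open>auto simp: fr3 fr2 fr R2 R3 capped\<close>)
      qed (use b u M in \<open>auto simp: fr2 fr\<close>)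
    next
      case (8 s2)
      have "s2 ''U'' u = of_bool (u \<notin> S)" "s2 ''s'' 0 = u"
        using 8(2) ctx1 u by (auto simp: ctx_def)
      moreover have "s2 ''y'' 0 = card {c. c < q \<and> ?diff u c}"
        using 8(1) by (simp add: n fr)
      moreover have "0 < card {c. c < q \<and> ?diff u c} \<longleftrightarrow> (\<exists>c<q. ?diff u c)"
        by (auto simp: card_gt_0_iff)
      ultimately show ?case by simp
    qed (use M in \<open>auto simp: n fr\<close>)
  next
    case (8 s')
    have "s' ''z'' 0 = 0 \<longleftrightarrow> {u. u < n \<and> u \<in> S \<and> (\<exists>c<q. ?diff u c)} = {}"
      using 8(1) by (simp add: n)
    also have "\<dots> \<longleftrightarrow> equiv_upto N S q ?i ?g ?h"
      using S unfolding equiv_upto_def by auto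
    finally show ?case
      by (rule Q) (use 8(2) in auto)
  qed (use M in \<open>auto simp: n\<close>)
qed

lemma rows_set_var [simp]: "x \<noteq> ''T'' \<Longrightarrow> rows n (set_var x m s) = rows n s"
  by (simp add: rows_def fun_eq_iff)

lemma rows_cong: "s' ''T'' = s ''T'' \<Longrightarrow> rows n s' = rows n s"
  by (simp add: rows_def fun_eq_iff)

lemma rows_Write:
  assumes "v < n" "j < n"
  shows "rows n (s(''T'' := (s ''T'')(e * n + j := c))) r v = (if r = e \<and> v = j then c else rows n s r v)"
  using row_index_eq_iff[OF assms] by (simp add: rows_def)

section \<open>Extending the representatives by one vertex\<close>

definition Append_Row :: com where
  "Append_Row = Seq
     (For ''v'' (V ''i'') (Write ''T'' (Add (Read ''mul'' (V ''e'')) (V ''v''))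
       (Read ''T'' (Add (Read ''mul'' (V ''r'')) (V ''v'')))))
     (Write ''T'' (Add (Read ''mul'' (V ''e'')) (V ''i'')) (V ''c''))"

lemma written_Append_Row [simp]: "written Append_Row = {''v'', ''T''}"
  by (auto simp: Append_Row_def)

lemma wp_Append_Row:
  assumes M: "n \<le> M" "1 \<le> M" and ctx: "ctx n q N S m s"
    and s: "s ''i'' 0 = i" "s ''r'' 0 = r" "s ''e'' 0 = e" "s ''c'' 0 = c"
    and i: "i < n" and r: "r < e" "e \<le> m"
    and Q: "\<And>s'. \<lbrakk>\<And>v. v < Suc i \<Longrightarrow> rows n s' e v = ((rows n s r)(i := c)) v;
        \<And>r v. r < e \<Longrightarrow> v < n \<Longrightarrow> rows n s' r v = rows n s r v;
        \<And>y. y \<notin> written Append_Row \<Longrightarrow> s' y = s y\<rbrakk> \<Longrightarrow> Q s'"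
  shows "wp M Append_Row Q s"
proof -
  \<comment> \<open>The source row lies before row \<open>e\<close>, so it stays intact, like all
    other earlier rows, while row \<open>e\<close> is filled.\<close>
  let ?I = "\<lambda>j s'. (\<forall>v<j. rows n s' e v = rows n s r v) \<and> (\<forall>r<e. \<forall>v<n. rows n s' r v = rows n s r v)"
  have mul: "s ''mul'' e = e * n" "s ''mul'' r = r * n" using ctx r by (auto simp: ctx_def)
  show ?thesis
    unfolding Append_Row_def
  proof (intro wp_Seq wp_For[where I = ?I], goal_cases)
    case (6 j s1)
    then have fr: "\<And>y. y \<notin> {''v'', ''T''} \<Longrightarrow> s1 y = s y" by auto
    have j: "j < i" using 6(1) s by simp
    show ?case
    proof (rule wp_Write, goal_cases)
      case 1
      have "s1 ''T'' (r * n + j) = rows n s r j"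
        using 6(3) r(1) j i by (auto simp: rows_def)
      then show ?case
        using 6(3) j i r(1) by (auto simp: fr s mul 6(2) rows_Write less_Suc_eq)
    qed
  next
    case (7 s1)
    then have fr: "\<And>y. y \<notin> {''v'', ''T''} \<Longrightarrow> s1 y = s y" by auto
    show ?case
    proof (rule wp_Write, rule Q, goal_cases)
      case (1 v)
      then show ?case using 7(1) i by (auto simp: fr s mul rows_Write less_Suc_eq)
    next
      case (2 r v)
      then show ?case using 7(1) i by (auto simp: fr s mul rows_Write)
    next
      case (3 y)
      then show ?case by (simp add: fr)
    qed
  qed (use M i s in auto)
qed

definition stage_inv ::
  "nat \<Rightarrow> nat \<Rightarrow> (nat \<Rightarrow> nat set) \<Rightarrow> nat set \<Rightarrow> nat \<Rightarrow> nat \<Rightarrow> nat \<Rightarrow> (nat \<times> nat) set \<Rightarrow> store \<Rightarrow> bool" where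
  "stage_inv n q N S i a b D s \<longleftrightarrow>
     ctx n q N S (max n (s ''e'' 0)) s \<and> s ''i'' 0 = i \<and> s ''a'' 0 = a \<and> s ''b'' 0 = b \<and> b \<le> s ''e'' 0 \<and>
     reps N S q i (rows n s) a b \<and> inequiv N S q (Suc i) (rows n s) b (s ''e'' 0) \<and>
     covers N S q i (rows n s) b (s ''e'' 0) D"

text \<open>Loops start at 0, so old rows are filtered out of the comparison by the test against
  \<open>''b''\<close>. When a row is kept, the next multiple of \<open>n\<close> is obtained from
  the last one by an addition.\<close>

definition Extend :: com where
  "Extend = Seq Append_Row (Seq
     (Count ''d'' ''g'' (V ''e'') Equiv (Conj (Neg (Less (V ''g'') (V ''b''))) (Eq (V ''z'') (Num 0))))
     (Cond (Eq (V ''d'') (Num 0))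
       (Seq (Write ''mul'' (Add (V ''e'') (Num 1)) (Add (Read ''mul'' (V ''e'')) (V ''n'')))
            (Set ''e'' (Add (V ''e'') (Num 1))))
       Skip))"

lemma written_Extend: "written Extend =
    {''v'', ''T'', ''d'', ''g'', ''z'', ''s'', ''y'', ''h'', ''k'', ''l'', ''mul'', ''e''}"
  by (auto simp: Extend_def)

lemma wp_Extend:
  assumes M: "n \<le> M" "1 \<le> M" "q \<le> M" "b + 3 ^ (card (N ` S) * q) \<le> M"
    and inv: "stage_inv n q N S i a b D s" and S: "S \<subseteq> {..<n}"
    and i: "i < n" and r: "s ''r'' 0 = r" "r \<in> {a..<b}" and c: "s ''c'' 0 = c" "c < q"
    and D: "D \<subseteq> {a..<b} \<times> {..<q}"
  shows "wp M Extend (stage_inv n q N S i a b (insert (r, c) D)) s"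
proof -
  define e where "e = s ''e'' 0"
  let ?m = "max n e" and ?eq = "equiv_upto N S q (Suc i)"
  from inv have ctx: "ctx n q N S ?m s" and s: "s ''i'' 0 = i" "s ''a'' 0 = a" "s ''b'' 0 = b"
    and be: "b \<le> e" and reps: "reps N S q i (rows n s) a b"
    and new: "inequiv N S q (Suc i) (rows n s) b e" and cov: "covers N S q i (rows n s) b e D"
    unfolding stage_inv_def e_def by auto
  have fin: "finite (N ` S)" using S finite_subset by blast
  \<comment> \<open>The comparison loop runs over all \<open>e\<close> rows; those from
    \<open>b\<close> on are pairwise inequivalent, hence few.\<close>
  have eM: "e \<le> M" using inequiv_bound[OF fin new] M(4) by linarith
  show ?thesis
    unfolding Extend_def
  proof (rule wp_Seq, rule wp_Append_Row[OF M(1,2) ctx s(1) r(1) e_def[symmetric] c(1) i], goal_cases)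
    case (3 s1)
    note ext = 3(1) and old = 3(2)
    have fr: "\<And>y. y \<notin> {''v'', ''T''} \<Longrightarrow> s1 y = s y" using 3(3) by simp
    have ctx1: "ctx n q N S ?m s1" using ctx by (subst ctx_cong[OF fr]) auto
    have n1: "s1 ''n'' 0 = n" using ctx1 by (simp add: ctx_def)
    define e' where "e' = (if \<exists>g\<in>{b..<e}. ?eq (rows n s1 g) (rows n s1 e) then e else Suc e)"
    have step: "reps N S q i (rows n s1) a b \<and> inequiv N S q (Suc i) (rows n s1) b e' \<and>
        covers N S q i (rows n s1) b e' (insert (r, c) D)"
      by (rule extend_step[OF reps new cov be r(2) c(2) D _ ext e'_def]) (use old i in auto)
    show ?case
    proof (rule wp_Seq, rule wp_Count[where P = "\<lambda>g. b \<le> g \<and> ?eq (rows n s1 g) (rows n s1 e)"], goal_cases)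
      case (7 g s2)
      then have g: "g < e" "s2 ''g'' 0 = g" and fr2: "\<And>y. y \<notin> insert ''d'' (insert ''g'' (written Equiv)) \<Longrightarrow> s2 y = s1 y"
        by (auto simp: fr e_def)
      have ctx2: "ctx n q N S ?m s2" using ctx1 by (subst ctx_cong[OF fr2]) auto
      have R2: "rows n s2 = rows n s1" by (rule rows_cong) (simp add: fr2)
      show ?case
      proof (rule wp_Equiv[OF M(1-3) ctx2 S], goal_cases)
        case (5 s3)
        have "s3 ''g'' 0 = g" "s3 ''b'' 0 = b"
          using 5(2) g by (simp_all add: fr2 fr s)
        then show ?case
          using 5(1) g by (simp add: fr2 fr s R2 not_less flip: e_def)
      qed (use g i in \<open>simp_all add: fr2 fr s flip: e_def\<close>)
    next
      case (8 s2)
      then have fr2: "\<And>y. y \<notin> insert ''d'' (insert ''g'' (written Equiv)) \<Longrightarrow> s2 y = s1 y" by auto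
      have ctx2: "ctx n q N S ?m s2" using ctx1 by (subst ctx_cong[OF fr2]) auto
      have "s2 ''d'' 0 = card {g. g < e \<and> b \<le> g \<and> ?eq (rows n s1 g) (rows n s1 e)}"
        using 8(1) by (simp add: fr e_def)
      then have d: "s2 ''d'' 0 = 0 \<longleftrightarrow> \<not> (\<exists>g\<in>{b..<e}. ?eq (rows n s1 g) (rows n s1 e))"
        by auto
      have e2: "s2 ''e'' 0 = e" by (simp add: fr2 fr e_def)
      have R2: "rows n s2 = rows n s1" by (rule rows_cong) (simp add: fr2)
      have mul: "s2 ''mul'' e = e * n" and n2: "s2 ''n'' 0 = n" using ctx2 by (auto simp: ctx_def)
      show ?case
      proof (intro wp_Cond wp_Seq wp_Set wp_Write wp_Skip M(2), goal_cases)
        case 1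
        then have e': "e' = Suc e" using d by (simp add: e'_def)
        let ?s = "s2(''mul'' := (s2 ''mul'')(Suc e := e * n + n))"
        have R: "rows n ?s = rows n s1" using R2 by (simp add: rows_def fun_eq_iff)
        have "ctx n q N S (max n (Suc e)) (set_var ''e'' (Suc e) ?s)"
          using ctx2 by (auto simp: ctx_def le_Suc_eq)
        moreover have "s2 ''i'' 0 = i" "s2 ''a'' 0 = a" "s2 ''b'' 0 = b"
          by (simp_all add: fr2 fr s)
        ultimately have "stage_inv n q N S i a b (insert (r, c) D) (set_var ''e'' (Suc e) ?s)"
          using step be unfolding stage_inv_def e' by (simp add: R)
        then show ?case by (simp add: e2 mul n2)
      next
        case 2
        then have e': "e' = e" using d by (simp add: e'_def)
        show ?case
          using step ctx2 be unfolding stage_inv_def e' by (simp add: R2 fr2 fr s e2 flip: e_def)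
      qed
    qed (use M eM in \<open>auto simp: fr simp flip: e_def\<close>)
  qed (use r be M in auto)
qed

text \<open>Rows of earlier levels are not freed, so \<open>''b''\<close> counts the rows of all
  levels: one for level 0 and at most one per equivalence class for each later level.\<close>

definition level_inv :: "nat \<Rightarrow> nat \<Rightarrow> (nat \<Rightarrow> nat set) \<Rightarrow> nat set \<Rightarrow> nat \<Rightarrow> store \<Rightarrow> bool" where
  "level_inv n q N S i s \<longleftrightarrow> ctx n q N S (max n (s ''b'' 0)) s \<and>
     reps N S q i (rows n s) (s ''a'' 0) (s ''b'' 0) \<and> s ''b'' 0 \<le> 1 + i * 3 ^ (card (N ` S) * q)"

lemma level_inv_cong:
  assumes "\<And>y. y \<in> {''n'', ''q'', ''adj'', ''U'', ''mul'', ''T'', ''a'', ''b''} \<Longrightarrow> s' y = s y"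
  shows "level_inv n q N S i s' = level_inv n q N S i s"
proof -
  have "ctx n q N S m s' = ctx n q N S m s" for m
    by (rule ctx_cong) (use assms in auto)
  moreover have "rows n s' = rows n s"
    by (rule rows_cong) (use assms in auto)
  ultimately show ?thesis unfolding level_inv_def using assms by simp
qed

definition Stage :: com where
  "Stage = Seq (Set ''e'' (V ''b'')) (Seq
     (For ''r'' (V ''b'') (Cond (Less (V ''r'') (V ''a'')) Skip (For ''c'' (V ''q'') Extend)))
     (Seq (Set ''a'' (V ''b'')) (Set ''b'' (V ''e''))))"

lemma written_Stage: "written Stage = {''a'', ''b'', ''r'', ''c''} \<union> written Extend"
  by (auto simp: Stage_def written_Extend)

lemma wp_Stage:
  assumes M: "n \<le> M" "1 \<le> M" "q \<le> M" "1 + n * 3 ^ (card (N ` S) * q) \<le> M"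
    and inv: "level_inv n q N S i s" and S: "S \<subseteq> {..<n}" and i: "i < n" "s ''i'' 0 = i"
  shows "wp M Stage (level_inv n q N S (Suc i)) s"
proof -
  define a b where ab: "a = s ''a'' 0" "b = s ''b'' 0"
  let ?L = "3 ^ (card (N ` S) * q)"
  from inv have ctx: "ctx n q N S (max n b) s" and reps: "reps N S q i (rows n s) a b"
    and b: "b \<le> 1 + i * ?L"
    unfolding level_inv_def ab by auto
  have fin: "finite (N ` S)" using S finite_subset by blast
  \<comment> \<open>As \<open>i < n\<close>, there is room for one more level below the bound for
    \<open>n\<close> levels.\<close>
  have bM: "b + ?L \<le> M"
  proof -
    have "Suc i * ?L \<le> n * ?L" using i(1) by (intro mult_le_mono1) simp
    then show ?thesis using b M(4) by simp
  qed
  let ?I = "\<lambda>D. stage_inv n q N S i a b D"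
  let ?s0 = "set_var ''e'' b s"
  have inv0: "?I {} ?s0"
  proof -
    have "ctx n q N S (max n b) ?s0" using ctx by (subst ctx_cong) auto
    then show ?thesis
      using reps i(2) unfolding stage_inv_def by (simp add: ab inequiv_def covers_def)
  qed
  have inv_set_var: "?I D (set_var x m s') = ?I D s'" if "x \<in> {''r'', ''c''}" for D x m s'
  proof -
    have "ctx n q N S k (set_var x m s') = ctx n q N S k s'" for k
      by (rule ctx_cong) (use that in auto)
    moreover have "x \<noteq> ''T''" "x \<noteq> ''e''" "x \<noteq> ''i''" "x \<noteq> ''a''" "x \<noteq> ''b''"
      using that by auto
    ultimately show ?thesis by (simp add: stage_inv_def)
  qed
  show ?thesis
    unfolding Stage_def
  \<comment> \<open>For \<open>r < a\<close> the interval \<open>{a..<r}\<close> is empty, so the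
    skipped rows leave the set of processed pairs empty.\<close>
  proof (intro wp_Seq wp_Set wp_For[where I = "\<lambda>r. ?I ({a..<r} \<times> {..<q})"], goal_cases)
    case 5
    then show ?case using inv0 by (simp add: inv_set_var flip: ab)
  next
    case (6 r s1)
    then have r: "r < b" "s1 ''r'' 0 = r" "?I ({a..<r} \<times> {..<q}) s1" by (auto simp: ab)
    have s1: "s1 ''a'' 0 = a" "s1 ''q'' 0 = q" using r(3) by (auto simp: stage_inv_def ctx_def)
    show ?case
    proof (intro wp_Cond M(2) wp_Skip, goal_cases)
      case 1
      then have "{a..<Suc r} = {a..<r}" using r(2) s1 by simp
      then show ?case using r by (simp add: inv_set_var)
    next
      case 2
      then have ar: "a \<le> r" using r(2) s1 by simp
      show ?case
      proof (rule wp_For[where I = "\<lambda>c. ?I ({a..<r} \<times> {..<q} \<union> {r} \<times> {..<c})"], goal_cases)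
        case (6 c s2)
        then have c: "c < q" "s2 ''c'' 0 = c" using s1 by auto
        have D: "insert (r, c) ({a..<r} \<times> {..<q} \<union> {r} \<times> {..<c}) = {a..<r} \<times> {..<q} \<union> {r} \<times> {..<Suc c}"
          by (auto simp: less_Suc_eq)
        have "wp M Extend (?I ({a..<r} \<times> {..<q} \<union> {r} \<times> {..<Suc c})) s2"
          unfolding D[symmetric]
        proof (rule wp_Extend[OF M(1-3) bM 6(3) S i(1)])
          show "s2 ''r'' 0 = r" using 6(4) r(2) by (simp add: written_Extend)
        qed (use r(1) ar c in auto)
        then show ?case by (simp add: inv_set_var)
      next
        case (7 s2)
        have "{a..<r} \<times> {..<q} \<union> {r} \<times> {..<q} = {a..<Suc r} \<times> {..<q}"
          using ar by auto
        then show ?case using 7(1) s1 by (simp add: inv_set_var)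
      qed (use M r s1 in \<open>auto simp: written_Extend inv_set_var\<close>)
    qed
  next
    case (7 s1)
    let ?e = "s1 ''e'' 0"
    have "?I ({a..<b} \<times> {..<q}) s1" using 7(1) by (simp add: ab)
    then have 1: "ctx n q N S (max n ?e) s1" "s1 ''b'' 0 = b" "inequiv N S q (Suc i) (rows n s1) b ?e"
      and 2: "reps N S q (Suc i) (rows n s1) b ?e"
      using reps_Suc unfolding stage_inv_def by auto
    have "?e \<le> 1 + Suc i * ?L" using inequiv_bound[OF fin 1(3)] b by simp
    moreover have "ctx n q N S (max n ?e) (set_var ''b'' ?e (set_var ''a'' b s1))"
      using 1(1) by (subst ctx_cong) auto
    ultimately show ?case using 1 2 by (simp add: level_inv_def)
  qed (use M bM in \<open>auto simp: written_Extend simp flip: ab\<close>)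
qed

definition Stages :: com where
  "Stages = Seq (Set ''a'' (Num 0)) (Seq (Set ''b'' (Num 1)) (For ''i'' (V ''n'') Stage))"

lemma written_Stages: "written Stages = {''a'', ''b'', ''r'', ''c'', ''i''} \<union> written Extend"
  by (auto simp: Stages_def written_Stage)

lemma wp_Stages:
  assumes M: "n \<le> M" "1 \<le> M" "q \<le> M" "1 + n * 3 ^ (card (N ` S) * q) \<le> M"
    and ctx: "ctx n q N S n s" and S: "S \<subseteq> {..<n}" and n: "1 \<le> n"
  shows "wp M Stages (level_inv n q N S n) s"
proof -
  have s: "s ''n'' 0 = n" using ctx by (simp add: ctx_def)
  have inv_set_var: "level_inv n q N S j (set_var ''i'' m s') = level_inv n q N S j s'" for j m s'
    by (rule level_inv_cong) auto
  have "ctx n q N S n (set_var ''b'' 1 (set_var ''a'' 0 s))"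
    using ctx by (subst ctx_cong) auto
  \<comment> \<open>One initial row requires multiples up to \<open>max n 1\<close>, which is
    \<open>n\<close> since there is a vertex.\<close>
  then have init: "level_inv n q N S 0 (set_var ''b'' 1 (set_var ''a'' 0 s))"
    using n reps_0[of N S q "rows n s"] by (simp add: level_inv_def max_absorb1)
  show ?thesis
    unfolding Stages_def
  proof (intro wp_Seq wp_Set wp_For[where I = "level_inv n q N S"], goal_cases)
    case (6 i s1)
    then show ?case
      unfolding inv_set_var by (intro wp_Stage[OF M _ S]) (auto simp: s)
  qed (use M init in \<open>auto simp: s inv_set_var written_Stage written_Extend\<close>)
qed

section \<open>Recognizing a solution among the representatives\<close>

definition colorable :: "(nat \<Rightarrow> nat set) \<Rightarrow> nat set \<Rightarrow> nat \<Rightarrow> nat \<Rightarrow> bool" where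
  "colorable N S n q \<longleftrightarrow> (\<exists>g. (\<forall>v<n. g v < q) \<and> good N S q n g)"

text \<open>Being \<open>good\<close> is invariant under equivalence, since capping at 2 still tells
  a count of 1 from all others.\<close>

lemma reps_colorable:
  assumes "reps N S q n R a b"
  shows "colorable N S n q \<longleftrightarrow> (\<exists>r\<in>{a..<b}. good N S q n (R r))"
proof
  assume "colorable N S n q"
  then obtain g where g: "\<forall>v<n. g v < q" "good N S q n g" unfolding colorable_def by blast
  then obtain r where "r \<in> {a..<b}" "equiv_upto N S q n g (R r)"
    using assms unfolding reps_def by blast
  then show "\<exists>r\<in>{a..<b}. good N S q n (R r)" using good_equiv g(2) by blast
next
  assume "\<exists>r\<in>{a..<b}. good N S q n (R r)"
  then show "colorable N S n q"
    using assms unfolding colorable_def reps_def inequiv_def by blast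
qed

definition Good_Row :: com where
  "Good_Row = Count ''z'' ''s'' (V ''n'')
     (Count ''y'' ''h'' (V ''q'') (Occ ''k'' ''r'' (V ''n'')) (Eq (V ''k'') (Num 1)))
     (Conj (Eq (Read ''U'' (V ''s'')) (Num 0)) (Eq (V ''y'') (Num 0)))"

lemma written_Good_Row: "written Good_Row = {''z'', ''s'', ''y'', ''h'', ''k'', ''v''}"
  by (auto simp: Good_Row_def)

lemma wp_Good_Row:
  assumes M: "n \<le> M" "1 \<le> M" "q \<le> M" and ctx: "ctx n q N S m s" and S: "S \<subseteq> {..<n}"
    and r: "s ''r'' 0 \<le> m" "n \<le> m"
    and Q: "\<And>s'. s' ''z'' 0 = 0 \<longleftrightarrow> good N S q n (rows n s (s ''r'' 0)) \<Longrightarrow>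
        (\<And>y. y \<notin> written Good_Row \<Longrightarrow> s' y = s y) \<Longrightarrow> Q s'"
  shows "wp M Good_Row Q s"
proof -
  let ?g = "rows n s (s ''r'' 0)"
  have n: "s ''n'' 0 = n" "s ''q'' 0 = q" using ctx by (auto simp: ctx_def)
  show ?thesis
    unfolding Good_Row_def
  proof (rule wp_Count[where P = "\<lambda>u. u \<in> S \<and> \<not> (\<exists>c<q. occ N ?g n u c = 1)"], goal_cases)
    case (7 u s1)
    then have u: "u < n" "s1 ''s'' 0 = u" and fr: "\<And>y. y \<notin> written Good_Row \<Longrightarrow> s1 y = s y"
      by (auto simp: n written_Good_Row)
    have ctx1: "ctx n q N S m s1" using ctx by (subst ctx_cong[OF fr]) (auto simp: written_Good_Row)
    show ?case
    proof (rule wp_Count[where P = "\<lambda>c. occ N ?g n u c = 1"], goal_cases)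
      case (7 c s2)
      then have c: "c < q" "s2 ''h'' 0 = c" and fr2: "\<And>y. y \<notin> {''y'', ''h'', ''k'', ''v''} \<Longrightarrow> s2 y = s1 y"
        by (auto simp: n fr written_Good_Row)
      have ctx2: "ctx n q N S m s2" using ctx1 by (subst ctx_cong[OF fr2]) auto
      have R2: "rows n s2 = rows n s" by (rule rows_cong) (simp add: fr2 fr written_Good_Row)
      show ?case
        by (rule wp_Occ[OF M(1,2) ctx2])
          (use r u c n in \<open>simp_all add: fr2 fr R2 written_Good_Row\<close>)
    next
      case (8 s2)
      have "s2 ''U'' u = of_bool (u \<notin> S)" "s2 ''s'' 0 = u"
        using 8(2) ctx1 u by (auto simp: ctx_def)
      moreover have "s2 ''y'' 0 = 0 \<longleftrightarrow> {c. c < q \<and> occ N ?g n u c = 1} = {}"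
        using 8(1) by (simp add: n fr written_Good_Row)
      ultimately show ?case by auto
    qed (use M in \<open>auto simp: n fr written_Good_Row\<close>)
  next
    case (8 s')
    have "s' ''z'' 0 = 0 \<longleftrightarrow> {u. u < n \<and> u \<in> S \<and> \<not> (\<exists>c<q. occ N ?g n u c = 1)} = {}"
      using 8(1) by (simp add: n)
    also have "\<dots> \<longleftrightarrow> good N S q n ?g"
      using S unfolding good_def by auto
    finally show ?case
      by (rule Q) (use 8(2) in \<open>auto simp: written_Good_Row\<close>)
  qed (use M in \<open>auto simp: n\<close>)
qed

text \<open>The entry of \<open>''mul''\<close> is included because the output step addresses row
  \<open>r\<close> through it.\<close>

definition solved :: "nat \<Rightarrow> nat \<Rightarrow> (nat \<Rightarrow> nat set) \<Rightarrow> nat set \<Rightarrow> store \<Rightarrow> bool" where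
  "solved n q N S s \<longleftrightarrow> (\<exists>r. s ''f'' 0 = Suc r \<and> s ''mul'' r = r * n \<and>
     (\<forall>v<n. rows n s r v < q) \<and> good N S q n (rows n s r))"

definition Check :: com where
  "Check = For ''r'' (V ''b'') (Cond (Less (V ''r'') (V ''a'')) Skip (Seq Good_Row
     (Cond (Eq (V ''z'') (Num 0)) (Set ''f'' (Add (V ''r'') (Num 1))) Skip)))"

lemma written_Check: "written Check = {''r'', ''f''} \<union> written Good_Row"
  by (auto simp: Check_def)

lemma wp_Check:
  assumes M: "n \<le> M" "1 \<le> M" "q \<le> M" "1 + n * 3 ^ (card (N ` S) * q) \<le> M"
    and inv: "level_inv n q N S n s" and S: "S \<subseteq> {..<n}" and f: "s ''f'' 0 = 0"
    and Q: "\<And>s'. if colorable N S n q then solved n q N S s' else s' ''f'' 0 = 0 \<Longrightarrow>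
        (\<And>y. y \<notin> written Check \<Longrightarrow> s' y = s y) \<Longrightarrow> Q s'"
  shows "wp M Check Q s"
proof -
  define a b where ab: "a = s ''a'' 0" "b = s ''b'' 0"
  from inv have ctx: "ctx n q N S (max n b) s" and reps: "reps N S q n (rows n s) a b"
    and b: "b \<le> 1 + n * 3 ^ (card (N ` S) * q)"
    unfolding level_inv_def ab by auto
  let ?good = "\<lambda>r. good N S q n (rows n s r)"
  \<comment> \<open>The loop does not stop at the first hit; later good rows overwrite
    \<open>''f''\<close>, and it does not matter which one survives.\<close>
  let ?I = "\<lambda>j s'. if \<exists>r\<in>{a..<j}. ?good r then \<exists>r\<in>{a..<j}. ?good r \<and> s' ''f'' 0 = Suc r else s' ''f'' 0 = 0"
  show ?thesis
    unfolding Check_def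
  proof (rule wp_For[where I = ?I], goal_cases)
    case (6 r s1)
    then have r: "r < b" "s1 ''r'' 0 = r" and fr: "\<And>y. y \<notin> written Check \<Longrightarrow> s1 y = s y"
      by (auto simp: ab written_Check)
    have ctx1: "ctx n q N S (max n b) s1"
      using ctx by (subst ctx_cong[OF fr]) (auto simp: written_Check written_Good_Row)
    have R1: "rows n s1 = rows n s"
      by (rule rows_cong) (simp add: fr written_Check written_Good_Row)
    have a1: "s1 ''a'' 0 = a" by (simp add: fr written_Check written_Good_Row ab)
    show ?case
    proof (intro wp_Cond wp_Skip wp_Seq M(2), goal_cases)
      case 1
      then have "{a..<Suc r} = {a..<r}" using r(2) a1 by simp
      then show ?case using 6(3) by simp
    next
      case 2
      then have ar: "{a..<Suc r} = insert r {a..<r}" using r(2) a1 by auto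
      show ?case
      proof (rule wp_Good_Row[OF M(1-3) ctx1 S], goal_cases)
        case (3 s2)
        have s2: "s2 ''r'' 0 = r" "s2 ''f'' 0 = s1 ''f'' 0" using 3(2) r(2) by (auto simp: written_Good_Row)
        have z: "s2 ''z'' 0 = 0 \<longleftrightarrow> ?good r" using 3(1) by (simp add: r(2) R1)
        show ?case
          by (intro wp_Cond wp_Set wp_Skip M(2)) (use 6(3) z s2 ar in auto)
      qed (use r in auto)
    qed
  next
    case (7 s1)
    then have fr: "\<And>y. y \<notin> written Check \<Longrightarrow> s1 y = s y" by (auto simp: written_Check)
    have ctx1: "ctx n q N S (max n b) s1"
      using ctx by (subst ctx_cong[OF fr]) (auto simp: written_Check written_Good_Row)
    have R1: "rows n s1 = rows n s"
      by (rule rows_cong) (simp add: fr written_Check written_Good_Row)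
    have "aval (V ''b'') s = b" by (simp add: ab)
    then have I: "?I b s1" using 7(1) by (simp only:)
    show ?case
    proof (rule Q[OF _ fr])
      show "if colorable N S n q then solved n q N S s1 else s1 ''f'' 0 = 0"
      proof (cases "\<exists>r\<in>{a..<b}. ?good r")
        case True
        then obtain r where r: "r \<in> {a..<b}" "?good r" "s1 ''f'' 0 = Suc r" using I by auto
        have "s1 ''mul'' r = r * n" using ctx1 r(1) by (auto simp: ctx_def le_max_iff_disj)
        moreover have "\<forall>v<n. rows n s r v < q"
          using reps r(1) unfolding reps_def inequiv_def by blast
        ultimately have "solved n q N S s1" using r unfolding solved_def R1 by blast
        then show ?thesis using True by (simp add: reps_colorable[OF reps])
      next
        case False
        then show ?thesis using I by (simp add: reps_colorable[OF reps])
      qed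
    qed
  qed (use M b f in \<open>auto simp: written_Good_Row simp flip: ab\<close>)
qed

section \<open>The least number of colors for the safe vertices\<close>

definition Search :: com where
  "Search = For ''p'' (Add (Add (V ''m'') (V ''m'')) (Num 1)) (Cond (Eq (V ''f'') (Num 0))
     (Seq (Set ''q'' (Add (V ''p'') (Num 1))) (Seq Stages Check)) Skip)"

lemma written_Search: "written Search = {''p'', ''q''} \<union> written Stages \<union> written Check"
  by (auto simp: Search_def)

lemmas written_all = written_Search written_Stages written_Extend written_Check written_Good_Row

text \<open>Numbers of colors are tried in increasing order, and \<open>''q''\<close> is frozen
  after the first success, hence least. By \<open>ex\<close> a success occurs within
  \<open>2 * d + 1\<close> rounds. Each round refills the table from its start, so the row bound for
  the largest \<open>q\<close> serves all rounds.\<close>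

lemma wp_Search:
  assumes M: "n \<le> M" "1 \<le> M" "2 * d + 1 \<le> M" "1 + n * 3 ^ (card (N ` S) * (2 * d + 1)) \<le> M"
    and ctx: "ctx n (s ''q'' 0) N S n s" and S: "S \<subseteq> {..<n}" and n: "1 \<le> n"
    and f: "s ''f'' 0 = 0" and d: "s ''m'' 0 = d" and ex: "colorable N S n (2 * d + 1)"
    and Q: "\<And>s'. \<lbrakk>solved n (s' ''q'' 0) N S s'; \<And>q. q < s' ''q'' 0 \<Longrightarrow> \<not> colorable N S n q;
        \<And>y. y \<notin> written Search \<Longrightarrow> s' y = s y\<rbrakk> \<Longrightarrow> Q s'"
  shows "wp M Search Q s"
proof -
  let ?I = "\<lambda>p s. ctx n (s ''q'' 0) N S n s \<and>
    (if s ''f'' 0 = 0 then \<forall>q\<le>p. \<not> colorable N S n q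
     else solved n (s ''q'' 0) N S s \<and> (\<forall>q<s ''q'' 0. \<not> colorable N S n q))"
  have I_set_var: "?I p (set_var ''p'' m s') = ?I p s'" for p m s'
  proof -
    have "ctx n q N S n (set_var ''p'' m s') = ctx n q N S n s'" for q
      by (rule ctx_cong) auto
    then show ?thesis by (simp add: solved_def)
  qed
  show ?thesis
    unfolding Search_def
  proof (rule wp_For[where I = ?I], goal_cases)
    case 5
    \<comment> \<open>The search begins with one color, so zero colors must be excluded separately;
      there is a vertex to color.\<close>
    have "\<not> colorable N S n 0" using n unfolding colorable_def by (metis less_le_trans not_less_zero zero_less_one)
    then show ?case unfolding I_set_var using ctx f by simp
  next
    case (6 p s1)
    then have p: "p < 2 * d + 1" "s1 ''p'' 0 = p" by (auto simp: d)
    let ?q = "Suc p"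
    have q: "?q \<le> M" and L: "1 + n * 3 ^ (card (N ` S) * ?q) \<le> M"
    proof -
      show "?q \<le> M" using p(1) M(3) by simp
      have "(3::nat) ^ (card (N ` S) * ?q) \<le> 3 ^ (card (N ` S) * (2 * d + 1))"
        using p(1) by (intro power_increasing mult_le_mono2) auto
      then have "n * 3 ^ (card (N ` S) * ?q) \<le> n * 3 ^ (card (N ` S) * (2 * d + 1))"
        by (rule mult_le_mono2)
      then show "1 + n * 3 ^ (card (N ` S) * ?q) \<le> M" using M(4) by linarith
    qed
    show ?case
      unfolding I_set_var
    proof (intro wp_Cond wp_Skip wp_Seq wp_Set M(2), goal_cases)
      case 1
      then have f1: "s1 ''f'' 0 = 0" "\<forall>q\<le>p. \<not> colorable N S n q" using 6(3) by auto
      let ?s = "set_var ''q'' ?q s1"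
      have ctx1: "ctx n ?q N S n ?s" using 6(3) by (auto simp: ctx_def)
      have "wp M Stages (wp M Check (?I ?q)) ?s"
      proof (rule wp_conseq[OF wp_Stages[OF M(1,2) q L ctx1 S n]], goal_cases)
        case (1 s2)
        have s2: "s2 ''q'' 0 = ?q" "s2 ''f'' 0 = 0" using 1(2) f1 by (auto simp: written_all)
        show ?case
        proof (rule wp_Check[OF M(1,2) q L 1(1) S s2(2)], goal_cases)
          case (1 s3)
          have fr: "s3 y = s2 y" if "y \<in> {''n'', ''q'', ''adj'', ''U'', ''mul''}" for y
            by (rule 1(2)) (use that in \<open>auto simp: written_all\<close>)
          have q3: "s3 ''q'' 0 = ?q" using fr s2(1) by simp
          have "ctx n ?q N S n s2"
            using \<open>level_inv n ?q N S n s2\<close> by (auto simp: level_inv_def ctx_def)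
          then have "ctx n ?q N S n s3" by (subst ctx_cong[OF fr])
          moreover have "s3 ''f'' 0 \<noteq> 0" if "solved n ?q N S s3"
            using that by (auto simp: solved_def)
          moreover have "\<forall>q<?q. \<not> colorable N S n q" using f1(2) by (simp add: less_Suc_eq_le)
          ultimately show ?case
            using 1(1) f1(2) unfolding q3 by (cases "colorable N S n ?q") (simp_all add: le_Suc_eq)
        qed
      qed
      then show ?case by (simp add: p(2))
    next
      case 2
      then show ?case using 6(3) by auto
    qed
  next
    case (7 s1)
    have "2 * d + 1 = aval (Add (Add (V ''m'') (V ''m'')) (Num 1)) s" using d by simp
    then have "?I (2 * d + 1) s1" using 7(1) by simp
    moreover have "s1 ''f'' 0 \<noteq> 0" using calculation ex by (auto split: if_splits)
    ultimately show ?case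
      by (intro Q) (use 7(2) in \<open>auto simp: written_Search\<close>)
  qed (use M d in \<open>auto simp: written_all\<close>)
qed

section \<open>Preparing the data and writing the output\<close>

definition Mul_Table :: com where
  "Mul_Table = For ''s'' (V ''n'') (Write ''mul'' (Add (V ''s'') (Num 1))
     (Add (Read ''mul'' (V ''s'')) (V ''n'')))"

lemma written_Mul_Table: "written Mul_Table = {''s'', ''mul''}"
  by (auto simp: Mul_Table_def)

lemma wp_Mul_Table:
  assumes M: "n \<le> M" "1 \<le> M" and s: "s ''n'' 0 = n" "s ''mul'' 0 = 0"
    and Q: "\<And>s'. \<forall>r\<le>n. s' ''mul'' r = r * n \<Longrightarrow> (\<And>y. y \<notin> written Mul_Table \<Longrightarrow> s' y = s y) \<Longrightarrow> Q s'"
  shows "wp M Mul_Table Q s"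
  unfolding Mul_Table_def
proof (rule wp_For[where I = "\<lambda>j s'. \<forall>r\<le>j. s' ''mul'' r = r * n"], goal_cases)
  case (6 j s1)
  then show ?case by (intro wp_Write) (auto simp: s le_Suc_eq)
next
  case (7 s1)
  then show ?case by (intro Q) (auto simp: s written_Mul_Table)
qed (use M s in auto)

definition Mark_Unsafe :: com where
  "Mark_Unsafe = For ''s'' (V ''n'') (Seq
     (Count ''k'' ''v'' (V ''n'') Skip (Conj
       (Eq (Read ''adj'' (Add (Read ''mul'' (V ''s'')) (V ''v''))) (Num 1))
       (Eq (Read ''X'' (V ''v'')) (Num 0))))
     (Cond (Conj (Eq (Read ''X'' (V ''s'')) (Num 0)) (Less (Num 0) (V ''k'')))
       (Write ''U'' (V ''s'') (Num 1)) Skip))"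

lemma written_Mark_Unsafe: "written Mark_Unsafe = {''s'', ''k'', ''v'', ''U''}"
  by (auto simp: Mark_Unsafe_def)

lemma wp_Mark_Unsafe:
  assumes M: "n \<le> M" "1 \<le> M" and s: "s ''n'' 0 = n" "\<forall>r\<le>n. s ''mul'' r = r * n" "\<forall>v. s ''U'' v = 0"
    and adj: "\<forall>u<n. \<forall>v<n. s ''adj'' (u * n + v) = of_bool (v \<in> nbhd G u)"
    and X: "\<forall>v. s ''X'' v = of_bool (v \<in> X)" and G: "\<And>u. nbhd G u \<subseteq> {..<n}"
    and Q: "\<And>s'. \<forall>u<n. s' ''U'' u = of_bool (\<not> safe G X u) \<Longrightarrow>
      (\<And>y. y \<notin> written Mark_Unsafe \<Longrightarrow> s' y = s y) \<Longrightarrow> Q s'"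
  shows "wp M Mark_Unsafe Q s"
  unfolding Mark_Unsafe_def
proof (rule wp_For[where I = "\<lambda>j s'. \<forall>u. s' ''U'' u = of_bool (u < j \<and> \<not> safe G X u)"], goal_cases)
  case (6 j s1)
  then have j: "j < n" "s1 ''s'' 0 = j" and fr: "\<And>y. y \<notin> {''s'', ''k'', ''v'', ''U''} \<Longrightarrow> s1 y = s y"
    by (auto simp: s)
  show ?case
  proof (rule wp_Seq, rule wp_Count[where P = "\<lambda>v. v \<in> nbhd G j \<and> v \<notin> X"], goal_cases)
    case (7 v s2)
    then show ?case using j by (intro wp_Skip) (auto simp: fr s adj X)
  next
    case (8 s2)
    have fr2: "s2 y = s1 y" if "y \<notin> {''k'', ''v''}" for y using 8(2) that by simp
    have "s2 ''k'' 0 = 0 \<longleftrightarrow> {v. v < n \<and> v \<in> nbhd G j \<and> v \<notin> X} = {}"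
      using 8(1) by (simp add: fr s)
    also have "\<dots> \<longleftrightarrow> nbhd G j \<subseteq> X" using G by auto
    finally have "j \<notin> X \<and> 0 < s2 ''k'' 0 \<longleftrightarrow> \<not> safe G X j" by (auto simp: safe_def)
    then show ?case
      using 6(3) j by (intro wp_Cond wp_Write wp_Skip M(2)) (auto simp: fr2 fr X less_Suc_eq)
  qed (use M in \<open>auto simp: fr s\<close>)
next
  case (7 s1)
  then show ?case by (intro Q) (auto simp: s written_Mark_Unsafe)
qed (use M s in auto)

text \<open>Adjacency of \<open>''x''\<close> to \<open>''w''\<close> is not tested: an apex is
  adjacent to every other unsafe vertex. If all vertices are safe, both variables keep their initial
  value 0, and recoloring vertex 0 does no harm.\<close>

definition Find_Apex :: com where
  "Find_Apex = Seq
     (For ''s'' (V ''n'') (Seq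
       (Count ''k'' ''v'' (V ''n'') Skip (Conj (Eq (Read ''U'' (V ''v'')) (Num 1)) (Conj
         (Neg (Eq (V ''v'') (V ''s'')))
         (Eq (Read ''adj'' (Add (Read ''mul'' (V ''s'')) (V ''v''))) (Num 0)))))
       (Cond (Conj (Eq (Read ''U'' (V ''s'')) (Num 1)) (Eq (V ''k'') (Num 0)))
         (Set ''w'' (V ''s'')) Skip)))
     (For ''v'' (V ''n'') (Cond
       (Conj (Eq (Read ''U'' (V ''v'')) (Num 1)) (Neg (Eq (V ''v'') (V ''w''))))
       (Set ''x'' (V ''v'')) Skip))"

lemma written_Find_Apex: "written Find_Apex = {''s'', ''k'', ''v'', ''w'', ''x''}"
  by (auto simp: Find_Apex_def)

definition apex :: "(nat \<Rightarrow> nat set) \<Rightarrow> nat set \<Rightarrow> nat \<Rightarrow> nat \<Rightarrow> bool" where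
  "apex N S n w \<longleftrightarrow> w < n \<and> w \<notin> S \<and> (\<forall>v<n. v \<notin> S \<longrightarrow> v \<noteq> w \<longrightarrow> v \<in> N w)"

lemma wp_Find_Apex:
  assumes M: "n \<le> M" "1 \<le> M" and ctx: "ctx n q N S n s"
    and Q: "\<And>s'. \<lbrakk>(\<exists>w. apex N S n w) \<Longrightarrow> apex N S n (s' ''w'' 0);
        (\<exists>v<n. v \<notin> S \<and> v \<noteq> s' ''w'' 0) \<Longrightarrow> s' ''x'' 0 < n \<and> s' ''x'' 0 \<notin> S \<and> s' ''x'' 0 \<noteq> s' ''w'' 0;
        \<And>y. y \<notin> written Find_Apex \<Longrightarrow> s' y = s y\<rbrakk> \<Longrightarrow> Q s'"
  shows "wp M Find_Apex Q s"
proof -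
  have s: "s ''n'' 0 = n" "\<forall>r\<le>n. s ''mul'' r = r * n" "\<forall>u<n. s ''U'' u = of_bool (u \<notin> S)"
    "\<forall>u<n. \<forall>v<n. s ''adj'' (u * n + v) = of_bool (v \<in> N u)"
    using ctx by (auto simp: ctx_def)
  show ?thesis
    unfolding Find_Apex_def
  proof (rule wp_Seq, rule wp_For[where I = "\<lambda>j s'. (\<exists>w<j. apex N S n w) \<longrightarrow> apex N S n (s' ''w'' 0)"], goal_cases)
    case (6 j s1)
    then have j: "j < n" "s1 ''s'' 0 = j" and fr: "\<And>y. y \<notin> {''s'', ''k'', ''v'', ''w''} \<Longrightarrow> s1 y = s y"
      by (auto simp: s)
    show ?case
    proof (rule wp_Seq, rule wp_Count[where P = "\<lambda>v. v \<notin> S \<and> v \<noteq> j \<and> v \<notin> N j"], goal_cases)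
      case (7 v s2)
      then show ?case using j by (intro wp_Skip) (auto simp: fr s)
    next
      case (8 s2)
      have fr2: "s2 y = s1 y" if "y \<notin> {''k'', ''v''}" for y using 8(2) that by simp
      have "s2 ''k'' 0 = 0 \<longleftrightarrow> {v. v < n \<and> v \<notin> S \<and> v \<noteq> j \<and> v \<notin> N j} = {}"
        using 8(1) by (simp add: fr s)
      then have "j \<notin> S \<and> s2 ''k'' 0 = 0 \<longleftrightarrow> apex N S n j"
        using j by (auto simp: apex_def)
      then show ?case
        using 6(3) j by (intro wp_Cond wp_Set wp_Skip M(2)) (auto simp: fr2 fr s less_Suc_eq)
    qed (use M in \<open>auto simp: fr s\<close>)
  next
    case (7 s1)
    then have w: "(\<exists>w. apex N S n w) \<longrightarrow> apex N S n (s1 ''w'' 0)" by (auto simp: s apex_def)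
    have fr: "\<And>y. y \<notin> {''s'', ''k'', ''v'', ''w''} \<Longrightarrow> s1 y = s y" using 7(2) by auto
    show ?case
    proof (rule wp_For[where I = "\<lambda>j s'. (\<exists>v<j. v \<notin> S \<and> v \<noteq> s1 ''w'' 0) \<longrightarrow>
        s' ''x'' 0 < n \<and> s' ''x'' 0 \<notin> S \<and> s' ''x'' 0 \<noteq> s1 ''w'' 0"], goal_cases)
      case (6 j s2)
      then have j: "j < n" "s2 ''v'' 0 = j" "s2 ''w'' = s1 ''w''" "s2 ''U'' j = of_bool (j \<notin> S)"
        by (auto simp: fr s)
      show ?case
        using 6(3) j by (intro wp_Cond wp_Set wp_Skip M(2)) (auto simp: less_Suc_eq)
    next
      case (7 s2)
      have "s2 ''w'' = s1 ''w''" using 7(2) by simp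
      then show ?case
        by (intro Q) (use w 7 in \<open>auto simp: written_Find_Apex fr s\<close>)
    qed (use M in \<open>auto simp: fr s\<close>)
  qed (use M in \<open>auto simp: s\<close>)
qed

text \<open>There are two shifts by one: \<open>''f''\<close> is the successor of a row index, and
  the table counts colors from 0.\<close>

definition Output :: com where
  "Output = Seq
     (For ''v'' (V ''n'') (Write ''col'' (V ''v'')
       (Add (Read ''T'' (Add (Read ''mul'' (Sub (V ''f'') (Num 1))) (V ''v''))) (Num 1))))
     (Seq (Write ''col'' (V ''w'') (Add (V ''q'') (Num 1)))
          (Write ''col'' (V ''x'') (Add (V ''q'') (Num 2))))"

lemma wp_Output:
  assumes M: "n \<le> M" "1 \<le> M" and s: "s ''n'' 0 = n" "s ''f'' 0 = Suc r" "s ''mul'' r = r * n"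
    and Q: "\<And>s' C. \<lbrakk>\<forall>v<n. C v = Suc (rows n s r v);
        s' ''col'' = C(s ''w'' 0 := s ''q'' 0 + 1, s ''x'' 0 := s ''q'' 0 + 2)\<rbrakk> \<Longrightarrow> Q s'"
  shows "wp M Output Q s"
  unfolding Output_def
proof (rule wp_Seq, rule wp_For[where I = "\<lambda>j s'. \<forall>v<j. s' ''col'' v = Suc (rows n s r v)"], goal_cases)
  case (6 j s1)
  then show ?case by (intro wp_Write) (auto simp: s rows_def less_Suc_eq)
next
  case (7 s1)
  show ?case
    by (intro wp_Seq wp_Write M(2), rule Q[of "s1 ''col''"]) (use 7 s in auto)
qed (use M s in auto)

section \<open>The complete algorithm, its time bound and its correctness\<close>

definition Approx_Coloring :: com where
  "Approx_Coloring = Seq Mul_Table (Seq Mark_Unsafe (Seq Find_Apex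
     (Seq (Count ''m'' ''v'' (V ''n'') Skip (Eq (Read ''X'' (V ''v'')) (Num 1)))
     (Seq Search Output))))"

lemma wp_Approx_Coloring:
  assumes M: "n \<le> M" "1 \<le> M" "2 * card X + 1 \<le> M"
      "1 + n * 3 ^ (card (nbhd G ` S) * (2 * card X + 1)) \<le> M"
    and G: "\<And>u. nbhd G u \<subseteq> {..<n}" and X: "X \<subseteq> {..<n}" and n: "1 \<le> n"
    and S: "S = {v. v < n \<and> safe G X v}"
    and ex: "colorable (nbhd G) S n (2 * card X + 1)"
    and Q: "\<And>s' C g q w x. \<lbrakk>s' ''col'' = C(w := q + 1, x := q + 2); \<forall>v<n. C v = Suc (g v);
        \<forall>v<n. g v < q; good (nbhd G) S q n g; \<And>q'. q' < q \<Longrightarrow> \<not> colorable (nbhd G) S n q';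
        (\<exists>w. apex (nbhd G) S n w) \<Longrightarrow> apex (nbhd G) S n w;
        (\<exists>v<n. v \<notin> S \<and> v \<noteq> w) \<Longrightarrow> x < n \<and> x \<notin> S \<and> x \<noteq> w\<rbrakk> \<Longrightarrow> Q s'"
  shows "wp M Approx_Coloring Q (graph_input n G X)"
proof -
  let ?s = "graph_input n G X"
  have Sn: "S \<subseteq> {..<n}" using S by auto
  have in_n: "?s ''n'' 0 = n" "?s ''mul'' 0 = 0" "\<forall>v. ?s ''U'' v = 0" "?s ''f'' 0 = 0" "?s ''q'' 0 = 0"
    and in_X: "\<forall>v. ?s ''X'' v = of_bool (v \<in> X)"
    and in_adj: "\<forall>u<n. \<forall>v<n. ?s ''adj'' (u * n + v) = of_bool (v \<in> nbhd G u)"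
    by (auto simp: graph_input_def scalar_def empty_store_def nbhd_def)
  show ?thesis
    unfolding Approx_Coloring_def
  proof (rule wp_Seq, rule wp_Mul_Table[where s = ?s, OF M(1,2) in_n(1,2)], goal_cases)
    case (1 s1)
    then have fr1: "\<And>y. y \<notin> {''s'', ''mul''} \<Longrightarrow> s1 y = ?s y" by (simp add: written_Mul_Table)
    show ?case
    proof (rule wp_Seq, rule wp_Mark_Unsafe[where s = s1 and X = X, OF M(1,2) _ 1(1) _ _ _ G], goal_cases)
      case (5 s2)
      then have fr2: "\<And>y. y \<notin> {''s'', ''k'', ''v'', ''U''} \<Longrightarrow> s2 y = s1 y" by (simp add: written_Mark_Unsafe)
      \<comment> \<open>The number of colors is 0 here because \<open>''q''\<close> is still unset
        before the search.\<close>
      have ctx2: "ctx n 0 (nbhd G) S n s2"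
        unfolding ctx_def using 1(1) 5(1) in_n in_adj by (auto simp: fr1 fr2 S)
      show ?case
      proof (rule wp_Seq, rule wp_Find_Apex[OF M(1,2) ctx2], goal_cases)
        case (1 s3)
        note apex = 1(1,2)
        have fr3: "\<And>y. y \<notin> {''s'', ''k'', ''v'', ''w'', ''x''} \<Longrightarrow> s3 y = s2 y" using 1(3) by (simp add: written_Find_Apex)
        show ?case
        proof (rule wp_Seq, rule wp_Count[where P = "\<lambda>v. v \<in> X"], goal_cases)
          case (7 v s4)
          then show ?case using in_X by (intro wp_Skip) (auto simp: fr1 fr2 fr3)
        next
          case (8 s4)
          then have fr4: "\<And>y. y \<notin> {''m'', ''v''} \<Longrightarrow> s4 y = s3 y" by simp
          have "{v. v < n \<and> v \<in> X} = X" using X by auto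
          then have m4: "s4 ''m'' 0 = card X" using 8(1) in_n by (simp add: fr1 fr2 fr3)
          have q4: "s4 ''q'' 0 = 0" "s4 ''f'' 0 = 0" using in_n by (simp_all add: fr1 fr2 fr3 fr4)
          have ctx4: "ctx n (s4 ''q'' 0) (nbhd G) S n s4"
            unfolding q4 using ctx2 by (subst ctx_cong[of s4 s2]) (auto simp: fr3 fr4)
          show ?case
          proof (rule wp_Seq, rule wp_Search[OF M ctx4 Sn n q4(2) m4 ex], goal_cases)
            case (1 s5)
            obtain r where r: "s5 ''f'' 0 = Suc r" "s5 ''mul'' r = r * n"
              "\<forall>v<n. rows n s5 r v < s5 ''q'' 0" "good (nbhd G) S (s5 ''q'' 0) n (rows n s5 r)"
              using 1(1) unfolding solved_def by blast
            have wx: "s5 ''w'' = s3 ''w''" "s5 ''x'' = s3 ''x''" "s5 ''n'' = s3 ''n''"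
              using 1(3) by (simp_all add: written_all fr4)
            then have n5: "s5 ''n'' 0 = n" using in_n by (simp add: fr1 fr2 fr3)
            show ?case
            proof (rule wp_Output[OF M(1,2) n5 r(1,2)], goal_cases)
              case (1 s6 C)
              show ?case
                by (rule Q[where s' = s6 and C = C and g = "rows n s5 r" and q = "s5 ''q'' 0" and w = "s5 ''w'' 0" and x = "s5 ''x'' 0",
                    OF 1(2,1) r(3,4)])
                  (use apex \<open>\<And>q. q < s5 ''q'' 0 \<Longrightarrow> \<not> colorable (nbhd G) S n q\<close> in \<open>simp_all add: wx\<close>)
            qed
          qed (use M in simp)
        qed (use M in_n in \<open>auto simp: fr1 fr2 fr3\<close>)
      qed (use M in simp)
    qed (use M in_n in_X in_adj in \<open>auto simp: fr1\<close>)
  qed (use M in simp)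
qed

text \<open>Brings the part of the time bound that depends on d into a form known to be computable.
  From \<open>d + 1 \<le> 2 ^ d\<close> the exponent of 3 is at most \<open>2 ^ (2 * d + 2)\<close>;
  replacing 3 by 4 adds one to the upper exponent, and absorbing the summand
  \<open>2 * d + 2\<close> adds another, which gives the 4. The power \<open>D\<close> and the
  factor \<open>K\<close> are absorbed by \<open>D + K\<close>.\<close>

lemma double_exp_bound:
  "K * (2 * d + 2 + 3 ^ ((d + 2 ^ d) * (2 * d + 1))) ^ D \<le> (2::nat) ^ 2 ^ (2 * d + (4 + D + K))"
proof -
  let ?e = "(2::nat) ^ (2 * d + 3)"
  have d: "d + 1 \<le> 2 ^ d" using less_exp[of d] by (simp add: Suc_leI)
  have "(d + 2 ^ d) * (2 * d + 1) \<le> 2 ^ (d + 1) * 2 ^ (d + 1)"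
    using d by (intro mult_le_mono) simp_all
  also have "\<dots> = 2 ^ ((d + 1) + (d + 1))" by (simp only: power_add)
  also have "(d + 1) + (d + 1) = 2 * d + 2" by simp
  finally have "(3::nat) ^ ((d + 2 ^ d) * (2 * d + 1)) \<le> 4 ^ 2 ^ (2 * d + 2)"
    by (intro order_trans[OF power_increasing power_mono]) auto
  also have "\<dots> = (2 ^ 2) ^ 2 ^ (2 * d + 2)" by simp
  also have "\<dots> = 2 ^ ?e" unfolding power_mult[symmetric] by (simp add: power_add)
  finally have 1: "(3::nat) ^ ((d + 2 ^ d) * (2 * d + 1)) \<le> 2 ^ ?e" .
  have "d + 1 \<le> ?e" using less_exp[of "2 * d + 3"] by linarith
  then have "(2::nat) ^ (d + 1) \<le> 2 ^ ?e" by (intro power_increasing) auto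
  then have 2: "2 * d + 2 \<le> 2 ^ ?e" using d by simp
  have "2 * d + 2 + 3 ^ ((d + 2 ^ d) * (2 * d + 1)) \<le> 2 * 2 ^ ?e" using 1 2 by linarith
  also have "\<dots> = 2 ^ Suc ?e" by simp
  also have "\<dots> \<le> 2 ^ 2 ^ (2 * d + 4)" by (intro power_increasing) (auto simp: power_add)
  finally have "(2 * d + 2 + 3 ^ ((d + 2 ^ d) * (2 * d + 1))) ^ D \<le> (2 ^ 2 ^ (2 * d + 4)) ^ D"
    by (rule power_mono) simp
  moreover have "K \<le> 2 ^ K" using less_exp[of K] by simp
  ultimately have "K * (2 * d + 2 + 3 ^ ((d + 2 ^ d) * (2 * d + 1))) ^ D \<le> 2 ^ K * (2 ^ 2 ^ (2 * d + 4)) ^ D"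
    by (intro mult_le_mono)
  also have "\<dots> = 2 ^ (K + 2 ^ (2 * d + 4) * D)" by (simp only: power_add power_mult)
  also have "\<dots> \<le> 2 ^ 2 ^ (2 * d + (4 + D + K))"
  proof (rule power_increasing)
    have "K + 2 ^ (2 * d + 4) * D \<le> 2 ^ (2 * d + 4) * (D + K)" by (simp add: distrib_left)
    also have "\<dots> \<le> 2 ^ (2 * d + 4) * 2 ^ (D + K)" using less_exp[of "D + K"] by (intro mult_le_mono2) simp
    also have "\<dots> = 2 ^ (2 * d + (4 + D + K))" by (simp add: power_add)
    finally show "K + 2 ^ (2 * d + 4) * D \<le> (2::nat) ^ (2 * d + (4 + D + K))" .
  qed simp
  finally show ?thesis .
qed

text \<open>\<open>M\<close> dominates the vertex loops, the color loops and the number of rows at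
  once. A product of \<open>n\<close> with a function of \<open>card X\<close> is chosen, rather
  than a sum, so that its powers factor.\<close>

lemma Approx_Coloring_correct:
  assumes G: "pair_graph G" "Digraph_Component.connected (with_proj G)"
    and n: "pverts G = {..<n}" "2 \<le> n"
    and X: "X \<subseteq> pverts G" "threshold (delete_verts G X)"
    and M: "M = n * (2 * card X + 2 + 3 ^ ((card X + 2 ^ card X) * (2 * card X + 1)))"
  shows "wp M Approx_Coloring (\<lambda>s. \<exists>k. cf_on_coloring G k (s ''col'') \<and> chi_cf G \<le> k \<and> k \<le> chi_cf G + 2)
    (graph_input n G X)"
proof -
  interpret pair_graph G by (rule G(1))
  define S where "S = {v. v < n \<and> safe G X v}"
  let ?d = "card X" and ?N = "nbhd G"
  let ?L = "\<lambda>m. 3 ^ (m * (2 * ?d + 1)) :: nat"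
  have N: "?N u \<subseteq> {..<n}" for u using in_arcsD2 n(1) by (auto simp: nbhd_def)
  have finX: "finite X" using X(1) n(1) finite_subset by auto
  have ne: "?N v \<noteq> {}" if "v \<in> pverts G" for v
    by (rule nbhd_nonempty[OF G(2) _ that]) (use n in simp)
  have good_iff: "good ?N S q n g \<longleftrightarrow> (\<forall>v<n. safe G X v \<longrightarrow> has_unique_color g (?N v))"
    if "\<forall>v<n. g v < q" for g q
    using good_iff_unique_color[of S ?N n g q] N that by (auto simp: S_def)
  have col: "colorable ?N S n (2 * ?d + 1)"
  proof -
    obtain C where "\<forall>v. C v < 2 * ?d + 1" "\<forall>v\<in>pverts G. safe G X v \<longrightarrow> has_unique_color C (?N v)"
      using exists_coloring_safe[OF ne X(1)] by blast
    then show ?thesis unfolding colorable_def using good_iff n(1) by (intro exI[of _ C]) auto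
  qed
  have bounds: "n \<le> M" "1 \<le> M" "2 * ?d + 1 \<le> M" "1 + n * ?L (card (?N ` S)) \<le> M"
  proof -
    have "card (?N ` S) \<le> ?d + 2 ^ ?d"
      using card_safe_nbhds[OF finX, of S G] by (auto simp: S_def)
    then have "?L (card (?N ` S)) \<le> ?L (?d + 2 ^ ?d)"
      by (intro power_increasing mult_le_mono1) auto
    then have "n * ?L (card (?N ` S)) \<le> n * ?L (?d + 2 ^ ?d)" by (rule mult_le_mono2)
    moreover have "M = n + n * (2 * ?d + 1) + n * ?L (?d + 2 ^ ?d)"
      unfolding M by (simp add: algebra_simps)
    moreover have "1 * (2 * ?d + 1) \<le> n * (2 * ?d + 1)" using n(2) by (intro mult_le_mono1) simp
    moreover have "n \<le> M \<and> 1 \<le> M \<and> e \<le> M \<and> 1 + a \<le> M"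
      if "a \<le> b" "M = n + c + b" "1 * e \<le> c" for a b c e
      using that n(2) by simp
    ultimately show "n \<le> M" "1 \<le> M" "2 * ?d + 1 \<le> M" "1 + n * ?L (card (?N ` S)) \<le> M"
      by blast+
  qed
  show ?thesis
  proof (rule wp_Approx_Coloring[OF bounds N _ _ S_def col], goal_cases)
    case (3 s' C g q w x)
    \<comment> \<open>An unsafe vertex is an end of an edge that avoids \<open>X\<close>. The
      dominating vertex \<open>w\<close> of the threshold graph is an apex, and a neighbor of it
      there is a second unsafe vertex.\<close>
    have unsafe: "\<exists>w. apex ?N S n w \<and> (\<exists>v<n. v \<notin> S \<and> v \<noteq> w)" if u: "u < n" "u \<notin> S" for u
    proof -
      let ?H = "delete_verts G X"
      have unsafe: "v \<notin> S \<longleftrightarrow> nbhd ?H v \<noteq> {}" if "v < n" for v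
        using that unsafe_iff[of G X v] by (simp add: S_def)
      have "nbhd ?H u \<noteq> {}" using u unsafe by simp
      then have "parcs ?H \<noteq> {}" by (auto simp: nbhd_def)
      then obtain w where w: "nbhd ?H w \<noteq> {}" "\<And>v. v \<noteq> w \<Longrightarrow> nbhd ?H v \<noteq> {} \<Longrightarrow> (w, v) \<in> parcs ?H"
        using threshold_dominating[OF X(2)] by blast
      then obtain v where v: "(w, v) \<in> parcs ?H" by (auto simp: nbhd_def)
      then have vw: "(w, v) \<in> parcs G" "w \<notin> X" "v \<notin> X" by (auto simp: delete_verts_def)
      have lt: "w < n" "v < n" using in_arcsD1[OF vw(1)] in_arcsD2[OF vw(1)] n(1) by auto
      have "v \<noteq> w" using pair_no_loops[OF vw(1)] by auto
      have "apex ?N S n w"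
        unfolding apex_def using lt(1) w(1) w(2) unsafe by (simp add: nbhd_def delete_verts_def)
      moreover have "v \<notin> S"
        using vw arc_sym[OF vw(1)] by (auto simp: S_def safe_def nbhd_def)
      ultimately show ?thesis using \<open>v \<noteq> w\<close> lt by blast
    qed
    have w: "apex ?N S n w" and x: "x < n" "x \<notin> S" "x \<noteq> w" if "u < n" "u \<notin> S" for u
    proof -
      show a: "apex ?N S n w" using unsafe[OF that] 3(6) by blast
      \<comment> \<open>The apex found by the program may differ from the one in
        \<open>unsafe\<close>, but the latter and its companion are two distinct unsafe vertices, so
        one of them is not \<open>w\<close>.\<close>
      have "\<exists>v<n. v \<notin> S \<and> v \<noteq> w"
      proof (rule ccontr)
        assume "\<not> ?thesis"
        then have "\<forall>v<n. v \<notin> S \<longrightarrow> v = w" by blast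
        then show False using unsafe[OF that] unfolding apex_def by metis
      qed
      then show "x < n" "x \<notin> S" "x \<noteq> w" using 3(7) by auto
    qed
    have "cf_on_coloring G (q + 2) (C(w := q + 1, x := q + 2))"
    proof (rule cf_on_coloring_extend)
      fix v assume v: "v \<in> pverts G"
      then show "C v \<in> {1..q}" using 3(2,3) n(1) by (auto simp: Suc_le_eq)
      show "has_unique_color C (?N v)" if "safe G X v"
      proof (rule has_unique_color_refine)
        show "has_unique_color g (?N v)" using 3(3,4) good_iff v that n(1) by auto
        show "g a = g b" if "a \<in> ?N v" "b \<in> ?N v" "C a = C b" for a b
        proof -
          have "a < n" "b < n" using that(1,2) N by blast+
          then show ?thesis using that(3) 3(2) by simp
        qed
      qed
      show "(w, v) \<in> parcs G" if "\<not> safe G X v" "v \<noteq> w"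
        using w[of v] v that n(1) by (auto simp: apex_def S_def nbhd_def)
      show "x \<noteq> w \<and> (w, x) \<in> parcs G" if "\<not> safe G X v"
        using w[of v] x[of v] v that n(1) by (auto simp: apex_def S_def nbhd_def)
    qed
    then have cf: "cf_on_coloring G (q + 2) (s' ''col'')" using 3(1) by simp
    then have le: "chi_cf G \<le> q + 2" unfolding chi_cf_def by (intro Least_le) blast
    \<comment> \<open>The coloring just produced also shows that the minimum defining
      \<open>chi_cf\<close> is attained.\<close>
    have "\<exists>C. cf_on_coloring G (chi_cf G) C"
      unfolding chi_cf_def by (rule LeastI_ex) (use cf in blast)
    then obtain D where D: "cf_on_coloring G (chi_cf G) D" ..
    then have D1: "D v \<in> {1..chi_cf G}" "has_unique_color D (?N v)" if "v < n" for v
      using that n(1) by (auto simp: cf_on_coloring_def)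
    \<comment> \<open>Lowering all colors by one is injective on positive colors. An optimal
      coloring of \<open>G\<close> thus becomes a candidate in the search, and minimality of
      \<open>q\<close> applies.\<close>
    have "colorable ?N S n (chi_cf G)"
      unfolding colorable_def
    proof (intro exI[of _ "\<lambda>v. D v - 1"] conjI)
      show lt: "\<forall>v<n. D v - 1 < chi_cf G" using D1(1) by fastforce
      have "has_unique_color (\<lambda>v. D v - 1) (?N v)" if "v < n" for v
      proof (rule has_unique_color_refine[OF D1(2)[OF that]])
        fix a b assume "a \<in> ?N v" "b \<in> ?N v" "D a - 1 = D b - 1"
        moreover have "D a \<ge> 1" "D b \<ge> 1" using calculation N[of v] D1(1) by auto
        ultimately show "D a = D b" by simp
      qed
      then show "good ?N S (chi_cf G) n (\<lambda>v. D v - 1)" unfolding good_iff[OF lt] by simp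
    qed
    then have "q \<le> chi_cf G" using 3(5) not_le by blast
    then show ?case using cf le by (intro exI[of _ "q + 2"]) simp
  qed (use X n in auto)
qed

theorem corollary1:
  shows "\<exists>f :: nat \<Rightarrow> nat. computable f \<and>
    (\<exists>(p :: com) (e :: nat). \<forall>(n :: nat) (G :: nat pair_pre_digraph) (X :: nat set) (d :: nat).
      pair_graph G \<and> Digraph_Component.connected (with_proj G) \<and>
      pverts G = {..<n} \<and> 2 \<le> n \<and>
      X \<subseteq> pverts G \<and> card X = d \<and> threshold (delete_verts G X) \<longrightarrow>
      (\<exists>(t :: nat) (s :: store). exec p (graph_input n G X) t s \<and> t \<le> f d * n ^ e \<and>
        (\<exists>k. cf_on_coloring G k (s ''col'') \<and> chi_cf G \<le> k \<and> k \<le> chi_cf G + 2)))"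
proof (rule exI, rule conjI)
  \<comment> \<open>The program is fixed, so its depth and weight are constants: the depth is the
    exponent of \<open>n\<close>, and both enter the constant of
    \<open>double_exp_bound\<close>.\<close>
  let ?c = "4 + depth Approx_Coloring + weight Approx_Coloring"
  show "computable (\<lambda>d. 2 ^ 2 ^ (2 * d + ?c))" by (rule computable_double_exp)
  show "\<exists>(p :: com) (e :: nat). \<forall>(n :: nat) (G :: nat pair_pre_digraph) (X :: nat set) (d :: nat).
      pair_graph G \<and> Digraph_Component.connected (with_proj G) \<and>
      pverts G = {..<n} \<and> 2 \<le> n \<and>
      X \<subseteq> pverts G \<and> card X = d \<and> threshold (delete_verts G X) \<longrightarrow>
      (\<exists>(t :: nat) (s :: store). exec p (graph_input n G X) t s \<and> t \<le> 2 ^ 2 ^ (2 * d + ?c) * n ^ e \<and>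
        (\<exists>k. cf_on_coloring G k (s ''col'') \<and> chi_cf G \<le> k \<and> k \<le> chi_cf G + 2))"
  proof (rule exI[of _ Approx_Coloring], rule exI[of _ "depth Approx_Coloring"], intro allI impI)
    fix n :: nat and G :: "nat pair_pre_digraph" and X :: "nat set" and d :: nat
    assume A: "pair_graph G \<and> Digraph_Component.connected (with_proj G) \<and>
        pverts G = {..<n} \<and> 2 \<le> n \<and>
        X \<subseteq> pverts G \<and> card X = d \<and> threshold (delete_verts G X)"
    let ?F = "2 * d + 2 + 3 ^ ((d + 2 ^ d) * (2 * d + 1)) :: nat"
    obtain t s where t: "exec Approx_Coloring (graph_input n G X) t s"
      "t \<le> weight Approx_Coloring * (n * ?F) ^ depth Approx_Coloring"
      "\<exists>k. cf_on_coloring G k (s ''col'') \<and> chi_cf G \<le> k \<and> k \<le> chi_cf G + 2"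
      using Approx_Coloring_correct[of G n X "n * ?F"] A unfolding wp_def by blast
    note t(2)
    also have "weight Approx_Coloring * (n * ?F) ^ depth Approx_Coloring =
        weight Approx_Coloring * ?F ^ depth Approx_Coloring * n ^ depth Approx_Coloring"
      by (simp only: power_mult_distrib mult_ac)
    also have "\<dots> \<le> 2 ^ 2 ^ (2 * d + ?c) * n ^ depth Approx_Coloring"
      by (intro mult_le_mono1 double_exp_bound)
    finally show "\<exists>t s. exec Approx_Coloring (graph_input n G X) t s \<and> t \<le> 2 ^ 2 ^ (2 * d + ?c) * n ^ depth Approx_Coloring \<and>
      (\<exists>k. cf_on_coloring G k (s ''col'') \<and> chi_cf G \<le> k \<and> k \<le> chi_cf G + 2)"
      using t(1,3) by blast
  qed
qed

end
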